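(* Fix an integer $d\ge 2$. Suppose there is a terminating algorithm which, for every integral alternating map (homomorphism) $\beta:\wedge^2\mathbb Z^d\to\mathbb Z^c$ with saturated kernel $L$, computes any one of the following: (1) the subgroup $D_\beta$; (2) the isomorphism type of $L/D_\beta$; (3) the integer $\operatorname{rk}(L/D_\beta)$. Then rational-point existence is decidable for every rational linear section $X_U=\mathbb P(U)\cap\operatorname{Gr}(2,d)$, where $U\le\wedge^2\mathbb Q^d$ is a $\mathbb Q$-subspace; that is, there is a terminating algorithm which, given such a $U$, decides whether $X_U(\mathbb Q)$ is nonempty.
   Context: For a homomorphism $\beta:\wedge^2\mathbb Z^d\to\mathbb Z^c$ with kernel $L$, put $D_\beta=\langle a\wedge b\mid a,b\in\mathbb Z^d,\ \beta(a\wedge b)=0\rangle\le L$. A sublattice $L\le\wedge^2\mathbb Z^d$ is saturated if $\wedge^2\mathbb Z^d/L$ is torsion-free. $\operatorname{Gr}(2,d)\subset\mathbb P(\wedge^2\mathbb Q^d)$ is the Grassmannian of $2$-dimensional subspaces in its Plücker embedding, i.e. the common zero locus of the quadrics $q_{ij}q_{k\ell}-q_{ik}q_{j\ell}+q_{i\ell}q_{jk}$ ($i<j<k<\ell$) in the coordinates $q=\sum_{i<j}q_{ij}\,e_i\wedge e_j$. $X_U(\mathbb Q)$ denotes the set of $\mathbb Q$-rational points of $X_U$. *)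

theory Defs
  imports
    Complex_Main
    "HOL-Algebra.Free_Abelian_Groups"
    "HOL-Library.Nat_Bijection"
begin

section \<open>Algorithms\<close>

text \<open>Algorithms are modelled by partial recursive functions (Kleene), in the unary
  formulation that uses the pairing bijection \<^const>\<open>prod_encode\<close>; \<^term>\<open>None\<close> means
  non-termination.\<close>

definition first_zero :: "(nat \<rightharpoonup> nat) \<Rightarrow> nat option" where
  "first_zero h =
     (if \<exists>k. h k = Some 0 \<and> (\<forall>j<k. \<exists>v. h j = Some (Suc v))
      then Some (LEAST k. h k = Some 0) else None)"

inductive partial_recursive :: "(nat \<rightharpoonup> nat) \<Rightarrow> bool" where
  zero: "partial_recursive (\<lambda>_. Some 0)"
| succ: "partial_recursive (\<lambda>n. Some (Suc n))"
| left: "partial_recursive (\<lambda>n. Some (fst (prod_decode n)))"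
| right: "partial_recursive (\<lambda>n. Some (snd (prod_decode n)))"
| pair: "\<lbrakk>partial_recursive f; partial_recursive g\<rbrakk> \<Longrightarrow>
    partial_recursive
      (\<lambda>n. Option.bind (f n) (\<lambda>x. Option.bind (g n) (\<lambda>y. Some (prod_encode (x, y)))))"
| comp: "\<lbrakk>partial_recursive f; partial_recursive g\<rbrakk> \<Longrightarrow>
    partial_recursive (\<lambda>n. Option.bind (g n) f)"
| prec: "\<lbrakk>partial_recursive f; partial_recursive g\<rbrakk> \<Longrightarrow>
    partial_recursive (\<lambda>n. case prod_decode n of (a, k) \<Rightarrow>
      rec_nat (f a)
        (\<lambda>y r. Option.bind r (\<lambda>i. g (prod_encode (a, prod_encode (y, i))))) k)"
| minim: "partial_recursive f \<Longrightarrow>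
    partial_recursive (\<lambda>a. first_zero (\<lambda>k. f (prod_encode (a, k))))"


section \<open>Abelian groups\<close>

definition torsion_free :: "('a, 'b) monoid_scheme \<Rightarrow> bool" where
  "torsion_free G \<longleftrightarrow>
     (\<forall>x\<in>carrier G. \<forall>n::nat. n > 0 \<longrightarrow> x [^]\<^bsub>G\<^esub> n = \<one>\<^bsub>G\<^esub> \<longrightarrow> x = \<one>\<^bsub>G\<^esub>)"

definition int_independent :: "('a, 'b) monoid_scheme \<Rightarrow> 'a set \<Rightarrow> bool" where
  "int_independent G S \<longleftrightarrow> finite S \<and> S \<subseteq> carrier G \<and>
     (\<forall>n :: 'a \<Rightarrow> int. finprod G (\<lambda>s. s [^]\<^bsub>G\<^esub> n s) S = \<one>\<^bsub>G\<^esub> \<longrightarrow> (\<forall>s\<in>S. n s = 0))"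

text \<open>Meaningful for abelian groups of finite rank only.\<close>

definition ab_rank :: "('a, 'b) monoid_scheme \<Rightarrow> nat" where
  "ab_rank G = (GREATEST r. \<exists>S. int_independent G S \<and> card S = r)"

text \<open>The direct sum of the \<open>\<int>/n\<close> for \<open>n\<close> in the list, where \<open>\<int>/0 = \<int>\<close>.\<close>

definition cyclic_sum :: "nat list \<Rightarrow> (nat \<Rightarrow> int) monoid" where
  "cyclic_sum ns = product_group {..<length ns} (\<lambda>i. integer_mod_group (ns ! i))"


section \<open>The exterior square\<close>

text \<open>\<open>\<int>\<^sup>n\<close> is the free abelian group on \<open>{..<n}\<close>. The exterior square of \<open>\<int>\<^sup>d\<close> is the free
  abelian group on the pairs \<open>(i, j)\<close> with \<open>i < j < d\<close>, where \<open>frag_of (i, j)\<close> stands for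
  \<open>e\<^sub>i \<and> e\<^sub>j\<close>.\<close>

definition wedge_index :: "nat \<Rightarrow> (nat \<times> nat) set" where
  "wedge_index d = {(i, j). i < j \<and> j < d}"

abbreviation int_vec :: "nat \<Rightarrow> (nat \<Rightarrow>\<^sub>0 int) monoid" where
  "int_vec n \<equiv> free_Abelian_group {..<n}"

abbreviation ext2_int :: "nat \<Rightarrow> ((nat \<times> nat) \<Rightarrow>\<^sub>0 int) monoid" where
  "ext2_int d \<equiv> free_Abelian_group (wedge_index d)"

definition wedge :: "nat \<Rightarrow> (nat \<Rightarrow>\<^sub>0 int) \<Rightarrow> (nat \<Rightarrow>\<^sub>0 int) \<Rightarrow> ((nat \<times> nat) \<Rightarrow>\<^sub>0 int)" where
  "wedge d a b = (\<Sum>(i, j)\<in>wedge_index d.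
     frag_cmul (Poly_Mapping.lookup a i * Poly_Mapping.lookup b j
                - Poly_Mapping.lookup a j * Poly_Mapping.lookup b i) (frag_of (i, j)))"

lemma finite_wedge_index: "finite (wedge_index d)"
  by (rule finite_subset[of _ "{..<d} \<times> {..<d}"]) (auto simp: wedge_index_def)

lemma lookup_wedge:
  "Poly_Mapping.lookup (wedge d a b) (i, j) =
     (if i < j \<and> j < d
      then Poly_Mapping.lookup a i * Poly_Mapping.lookup b j
           - Poly_Mapping.lookup a j * Poly_Mapping.lookup b i
      else 0)"
proof -
  let ?f = "\<lambda>p. Poly_Mapping.lookup a (fst p) * Poly_Mapping.lookup b (snd p)
                - Poly_Mapping.lookup a (snd p) * Poly_Mapping.lookup b (fst p)"
  have "Poly_Mapping.lookup (wedge d a b) (i, j) =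
      (\<Sum>p\<in>wedge_index d. ?f p * (if (i, j) = p then 1 else 0))"
    by (simp add: wedge_def lookup_sum case_prod_beta)
  also have "\<dots> = (\<Sum>p\<in>wedge_index d. if p = (i, j) then ?f p else 0)"
    by (rule sum.cong) auto
  also have "\<dots> = (if (i, j) \<in> wedge_index d then ?f (i, j) else 0)"
    by (subst sum.delta[OF finite_wedge_index]) auto
  finally show ?thesis
    by (simp add: wedge_index_def)
qed

lemma wedge_in_carrier: "wedge d a b \<in> carrier (ext2_int d)"
  by (auto simp: free_Abelian_group_def in_keys_iff lookup_wedge wedge_index_def
      split: if_splits)

lemma wedge_self: "wedge d a a = 0"
  by (rule poly_mapping_eqI) (auto simp: lookup_wedge split_paired_all)

lemma wedge_basis: "i < j \<Longrightarrow> j < d \<Longrightarrow> wedge d (frag_of i) (frag_of j) = frag_of (i, j)"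
  by (rule poly_mapping_eqI) (auto simp: lookup_wedge split_paired_all)

definition alternating_map ::
  "nat \<Rightarrow> nat \<Rightarrow> (((nat \<times> nat) \<Rightarrow>\<^sub>0 int) \<Rightarrow> (nat \<Rightarrow>\<^sub>0 int)) \<Rightarrow> bool" where
  "alternating_map d c \<beta> \<longleftrightarrow> \<beta> \<in> hom (ext2_int d) (int_vec c)"

definition ker_lattice ::
  "nat \<Rightarrow> nat \<Rightarrow> (((nat \<times> nat) \<Rightarrow>\<^sub>0 int) \<Rightarrow> (nat \<Rightarrow>\<^sub>0 int)) \<Rightarrow> ((nat \<times> nat) \<Rightarrow>\<^sub>0 int) set" where
  "ker_lattice d c \<beta> = kernel (ext2_int d) (int_vec c) \<beta>"

definition decomposable_subgroup ::
  "nat \<Rightarrow> nat \<Rightarrow> (((nat \<times> nat) \<Rightarrow>\<^sub>0 int) \<Rightarrow> (nat \<Rightarrow>\<^sub>0 int)) \<Rightarrow> ((nat \<times> nat) \<Rightarrow>\<^sub>0 int) set" where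
  "decomposable_subgroup d c \<beta> =
     generate (ext2_int d)
       {wedge d a b | a b. a \<in> carrier (int_vec d) \<and> b \<in> carrier (int_vec d)
          \<and> \<beta> (wedge d a b) = \<one>\<^bsub>int_vec c\<^esub>}"

definition ker_quotient ::
  "nat \<Rightarrow> nat \<Rightarrow> (((nat \<times> nat) \<Rightarrow>\<^sub>0 int) \<Rightarrow> (nat \<Rightarrow>\<^sub>0 int)) \<Rightarrow> ((nat \<times> nat) \<Rightarrow>\<^sub>0 int) set monoid" where
  "ker_quotient d c \<beta> =
     (ext2_int d)\<lparr>carrier := ker_lattice d c \<beta>\<rparr> Mod decomposable_subgroup d c \<beta>"

definition saturated :: "nat \<Rightarrow> ((nat \<times> nat) \<Rightarrow>\<^sub>0 int) set \<Rightarrow> bool" where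
  "saturated d L \<longleftrightarrow> subgroup L (ext2_int d) \<and> torsion_free (ext2_int d Mod L)"


section \<open>Linear sections of the Grassmannian\<close>

definition rat_scale :: "rat \<Rightarrow> ('i \<Rightarrow>\<^sub>0 rat) \<Rightarrow> ('i \<Rightarrow>\<^sub>0 rat)" where
  "rat_scale r q = Poly_Mapping.map ((*) r) q"

lemma lookup_rat_scale [simp]:
  "Poly_Mapping.lookup (rat_scale r q) i = r * Poly_Mapping.lookup q i"
  by (simp add: rat_scale_def Poly_Mapping.map.rep_eq when_def)

global_interpretation rat_vec: vector_space rat_scale
  by unfold_locales (auto intro!: poly_mapping_eqI simp: lookup_add algebra_simps)

definition ext2_rat :: "nat \<Rightarrow> ((nat \<times> nat) \<Rightarrow>\<^sub>0 rat) set" where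
  "ext2_rat d = {q. Poly_Mapping.keys q \<subseteq> wedge_index d}"

text \<open>The rational points of the projective space of a rational vector space are its lines.\<close>

definition proj_points :: "('i \<Rightarrow>\<^sub>0 rat) set \<Rightarrow> ('i \<Rightarrow>\<^sub>0 rat) set set" where
  "proj_points U = {rat_vec.span {q} | q. q \<in> U \<and> q \<noteq> 0}"

definition on_plucker_quadrics :: "nat \<Rightarrow> ((nat \<times> nat) \<Rightarrow>\<^sub>0 rat) \<Rightarrow> bool" where
  "on_plucker_quadrics d q \<longleftrightarrow>
     (\<forall>i j k l. i < j \<and> j < k \<and> k < l \<and> l < d \<longrightarrow>
        Poly_Mapping.lookup q (i, j) * Poly_Mapping.lookup q (k, l)
        - Poly_Mapping.lookup q (i, k) * Poly_Mapping.lookup q (j, l)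
        + Poly_Mapping.lookup q (i, l) * Poly_Mapping.lookup q (j, k) = 0)"

definition grassmannian_points :: "nat \<Rightarrow> ((nat \<times> nat) \<Rightarrow>\<^sub>0 rat) set set" where
  "grassmannian_points d = {P \<in> proj_points (ext2_rat d). \<forall>q\<in>P. on_plucker_quadrics d q}"

definition section_points ::
  "nat \<Rightarrow> ((nat \<times> nat) \<Rightarrow>\<^sub>0 rat) set \<Rightarrow> ((nat \<times> nat) \<Rightarrow>\<^sub>0 rat) set set" where
  "section_points d U = proj_points U \<inter> grassmannian_points d"


section \<open>Encodings of inputs and outputs\<close>

definition wedge_index_list :: "nat \<Rightarrow> (nat \<times> nat) list" where
  "wedge_index_list d = concat (map (\<lambda>i. map (Pair i) [Suc i..<d]) [0..<d])"

lemma set_wedge_index_list: "set (wedge_index_list d) = wedge_index d"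
  by (force simp: wedge_index_list_def wedge_index_def)

definition rat_encode :: "rat \<Rightarrow> nat" where
  "rat_encode r = (case quotient_of r of (a, b) \<Rightarrow> prod_encode (int_encode a, nat b))"

definition ext2_code :: "('a::zero \<Rightarrow> nat) \<Rightarrow> nat \<Rightarrow> ((nat \<times> nat) \<Rightarrow>\<^sub>0 'a) list \<Rightarrow> nat" where
  "ext2_code enc d qs =
     list_encode (map (\<lambda>q. list_encode (map (\<lambda>p. enc (Poly_Mapping.lookup q p))
       (wedge_index_list d))) qs)"

text \<open>A map \<open>\<beta>\<close> is given to an algorithm by \<open>c\<close> and its integer matrix, that is, by the
  coordinate vectors of the \<open>\<beta> (e\<^sub>i \<and> e\<^sub>j)\<close>.\<close>

definition map_code ::
  "nat \<Rightarrow> nat \<Rightarrow> (((nat \<times> nat) \<Rightarrow>\<^sub>0 int) \<Rightarrow> (nat \<Rightarrow>\<^sub>0 int)) \<Rightarrow> nat" where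
  "map_code d c \<beta> = prod_encode (c,
     list_encode (map (\<lambda>p. list_encode (map (\<lambda>k.
       int_encode (Poly_Mapping.lookup (\<beta> (frag_of p)) k)) [0..<c])) (wedge_index_list d)))"


section \<open>The algorithmic problems\<close>

text \<open>Nothing is required of an algorithm on numbers that do not encode an admissible input.
  A subgroup is output as a finite list of generators, and the isomorphism type of a finitely
  generated abelian group as a list of orders of cyclic summands (order 0 for an infinite one).
  Neither list is required to be in a normal form.\<close>

definition computes_decomposable_subgroup :: "nat \<Rightarrow> (nat \<rightharpoonup> nat) \<Rightarrow> bool" where
  "computes_decomposable_subgroup d F \<longleftrightarrow>
     (\<forall>c \<beta>. alternating_map d c \<beta> \<and> saturated d (ker_lattice d c \<beta>) \<longrightarrow>
        (\<exists>ws. set ws \<subseteq> carrier (ext2_int d)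
            \<and> generate (ext2_int d) (set ws) = decomposable_subgroup d c \<beta>
            \<and> F (map_code d c \<beta>) = Some (ext2_code int_encode d ws)))"

definition computes_quotient_type :: "nat \<Rightarrow> (nat \<rightharpoonup> nat) \<Rightarrow> bool" where
  "computes_quotient_type d F \<longleftrightarrow>
     (\<forall>c \<beta>. alternating_map d c \<beta> \<and> saturated d (ker_lattice d c \<beta>) \<longrightarrow>
        (\<exists>ns. ker_quotient d c \<beta> \<cong> cyclic_sum ns
            \<and> F (map_code d c \<beta>) = Some (list_encode ns)))"

definition computes_quotient_rank :: "nat \<Rightarrow> (nat \<rightharpoonup> nat) \<Rightarrow> bool" where
  "computes_quotient_rank d F \<longleftrightarrow>
     (\<forall>c \<beta>. alternating_map d c \<beta> \<and> saturated d (ker_lattice d c \<beta>) \<longrightarrow>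
        F (map_code d c \<beta>) = Some (ab_rank (ker_quotient d c \<beta>)))"

text \<open>The subspace \<open>U\<close> is given by an arbitrary finite spanning list; the answer is 1 for yes
  and 0 for no.\<close>

definition decides_section_points :: "nat \<Rightarrow> (nat \<rightharpoonup> nat) \<Rightarrow> bool" where
  "decides_section_points d F \<longleftrightarrow>
     (\<forall>U us. rat_vec.subspace U \<and> U \<subseteq> ext2_rat d \<and> rat_vec.span (set us) = U \<longrightarrow>
        F (ext2_code rat_encode d us) = Some (if section_points d U \<noteq> {} then 1 else 0))"

end

theory Submission
  imports Defs
begin

text \<open>A rational subspace \<open>U\<close> is the rational span of its saturated lattice \<open>L\<close> of integer points, and
  a rational point of \<open>X\<^sub>U\<close> is the same as a nonzero decomposable vector of \<open>L\<close>. So \<open>X\<^sub>U\<close> has a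
  rational point iff \<open>D\<^sub>\<beta> \<noteq> 0\<close>, where \<open>\<beta>\<close> is an integer matrix with kernel \<open>L\<close>; as \<open>L\<close> is free, this
  is also equivalent to \<open>rk (L/D\<^sub>\<beta>) < rk L = dim U\<close>. To compute \<open>\<beta>\<close> and \<open>dim U\<close> from a spanning list
  of \<open>U\<close>, no elimination algorithm is needed: an unbounded search finds them together with a
  certificate of correctness, which exists by linear algebra and is checked by
  finitely many rational identities.\<close>

section \<open>Total recursive functions\<close>

text \<open>The rank test needs rk \<open>L\<close> besides rk \<open>L/D\<close>, and whatever is
  computed around the assumed algorithm has to be built from the partial recursive schemes by hand.
  One certificate serves both ends: its matrix is the query, and its number of pivots is rk
  \<open>L\<close>. The search returns the least accepted number, not a witness of known origin, so
  acceptance alone must imply correctness, and malformed numbers must be read harmlessly; hence all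
  the default values 0. Two facts let integers replace rationals. The target Z^c is torsion-free, so
  the kernel of every integer matrix is saturated and each query is admissible. And a vector x of
  \<open>L\<close> on the Pluecker quadrics need not be divided: contracting it with two basis
  directions i, j exhibits x_ij x as a wedge of integer vectors, and this multiple is still in
  \<open>L\<close>. The answers of the assumed algorithm are in no normal form, so they are only
  asked invariant questions: whether all listed generators vanish, or how many listed summands are
  infinite.\<close>

definition total_rec :: "(nat \<Rightarrow> nat) \<Rightarrow> bool" where
  "total_rec f \<longleftrightarrow> partial_recursive (\<lambda>n. Some (f n))"

definition total_rec2 :: "(nat \<Rightarrow> nat \<Rightarrow> nat) \<Rightarrow> bool" where
  "total_rec2 f \<longleftrightarrow> total_rec (\<lambda>m. f (fst (prod_decode m)) (snd (prod_decode m)))"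

lemma total_rec_fst_decode: "total_rec (\<lambda>n. fst (prod_decode n))"
  unfolding total_rec_def by (rule partial_recursive.left)

lemma total_rec_snd_decode: "total_rec (\<lambda>n. snd (prod_decode n))"
  unfolding total_rec_def by (rule partial_recursive.right)

lemma total_rec_comp: "total_rec f \<Longrightarrow> total_rec g \<Longrightarrow> total_rec (\<lambda>n. f (g n))"
  unfolding total_rec_def using partial_recursive.comp[of "\<lambda>n. Some (f n)" "\<lambda>n. Some (g n)"] by simp

lemma total_rec_pair:
  "total_rec f \<Longrightarrow> total_rec g \<Longrightarrow> total_rec (\<lambda>n. prod_encode (f n, g n))"
  unfolding total_rec_def using partial_recursive.pair[of "\<lambda>n. Some (f n)" "\<lambda>n. Some (g n)"] by simp

lemma total_rec_id: "total_rec (\<lambda>n. n)"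
  using total_rec_pair[OF total_rec_fst_decode total_rec_snd_decode] by simp

lemma total_rec_fst: "total_rec f \<Longrightarrow> total_rec (\<lambda>n. fst (prod_decode (f n)))"
  by (rule total_rec_comp[OF total_rec_fst_decode])

lemma total_rec_snd: "total_rec f \<Longrightarrow> total_rec (\<lambda>n. snd (prod_decode (f n)))"
  by (rule total_rec_comp[OF total_rec_snd_decode])

lemma total_rec_Suc: "total_rec f \<Longrightarrow> total_rec (\<lambda>n. Suc (f n))"
  using total_rec_comp[of Suc f] partial_recursive.succ by (simp add: total_rec_def)

lemma total_rec_const: "total_rec (\<lambda>_. c)"
proof (induction c)
  case 0
  show ?case unfolding total_rec_def by (rule partial_recursive.zero)
qed (rule total_rec_Suc)

lemma total_rec2_apply:
  "total_rec2 f \<Longrightarrow> total_rec a \<Longrightarrow> total_rec b \<Longrightarrow> total_rec (\<lambda>n. f (a n) (b n))"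
  unfolding total_rec2_def using total_rec_comp[OF _ total_rec_pair[of a b]] by fastforce

text \<open>With total ingredients the scheme \<open>prec\<close> never meets \<open>None\<close>,
  so its chain of \<open>Option.bind\<close> collapses to a plain \<open>rec_nat\<close>. The
  argument \<open>n\<close> is passed as the parameter and \<open>b n\<close> as the number of
  steps, which lets the step function depend on \<open>n\<close>.\<close>

lemma total_rec_rec_nat:
  assumes f: "total_rec f" and b: "total_rec b"
    and g: "total_rec (\<lambda>m. g (fst (prod_decode m)) (fst (prod_decode (snd (prod_decode m))))
      (snd (prod_decode (snd (prod_decode m)))))"
  shows "total_rec (\<lambda>n. rec_nat (f n) (\<lambda>y r. g n y r) (b n))"
proof -
  let ?g = "\<lambda>m. g (fst (prod_decode m)) (fst (prod_decode (snd (prod_decode m))))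
      (snd (prod_decode (snd (prod_decode m))))"
  have rec_Some: "rec_nat (Some (f a)) (\<lambda>y r. Option.bind r (\<lambda>i. Some (?g (prod_encode (a, prod_encode (y, i)))))) k
      = Some (rec_nat (f a) (g a) k)" for a k
    by (induction k) auto
  have "total_rec2 (\<lambda>a k. rec_nat (f a) (g a) k)"
    using partial_recursive.prec[of "\<lambda>n. Some (f n)" "\<lambda>n. Some (?g n)"] f g
    unfolding total_rec2_def total_rec_def by (simp only: rec_Some case_prod_beta)
  from total_rec2_apply[OF this total_rec_id b] show ?thesis by simp
qed

lemmas total_rec_basic = total_rec_id total_rec_const total_rec_fst total_rec_snd total_rec_pair
  total_rec_Suc

section \<open>Arithmetic of natural numbers by primitive recursion\<close>

lemma total_rec_add:
  assumes "total_rec a" "total_rec b"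
  shows "total_rec (\<lambda>n. a n + b n)"
proof -
  have "rec_nat i (\<lambda>_ r. Suc r) k = i + k" for i k :: nat by (induction k) auto
  moreover have "total_rec (\<lambda>n. rec_nat (a n) (\<lambda>_ r. Suc r) (b n))"
    by (intro total_rec_rec_nat total_rec_basic assms)
  ultimately show ?thesis by simp
qed

lemma total_rec_mult:
  assumes "total_rec a" "total_rec b"
  shows "total_rec (\<lambda>n. a n * b n)"
proof -
  have "rec_nat 0 (\<lambda>_ r. r + i) k = i * k" for i k :: nat by (induction k) auto
  moreover have "total_rec (\<lambda>n. rec_nat 0 (\<lambda>_ r. r + a n) (b n))"
    by (intro total_rec_rec_nat total_rec_basic total_rec_add assms
        total_rec_comp[OF assms(1)])
  ultimately show ?thesis by simp
qed

lemma total_rec_pred: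
  assumes "total_rec a"
  shows "total_rec (\<lambda>n. a n - 1)"
proof -
  have "rec_nat 0 (\<lambda>y _. y) k = k - 1" for k :: nat by (induction k) auto
  moreover have "total_rec (\<lambda>n. rec_nat 0 (\<lambda>y _. y) (a n))"
    by (intro total_rec_rec_nat total_rec_basic assms)
  ultimately show ?thesis by simp
qed

lemma total_rec_diff:
  assumes "total_rec a" "total_rec b"
  shows "total_rec (\<lambda>n. a n - b n)"
proof -
  have "rec_nat i (\<lambda>_ r. r - 1) k = i - k" for i k :: nat by (induction k) auto
  moreover have "total_rec (\<lambda>n. rec_nat (a n) (\<lambda>_ r. r - 1) (b n))"
    by (intro total_rec_rec_nat total_rec_basic total_rec_pred assms)
  ultimately show ?thesis by simp
qed

lemma total_rec_parity:
  assumes "total_rec a"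
  shows "total_rec (\<lambda>n. a n mod 2)"
proof -
  have "rec_nat 0 (\<lambda>_ r. 1 - r) k = k mod 2" for k :: nat
    by (induction k) (auto simp: mod_Suc)
  moreover have "total_rec (\<lambda>n. rec_nat 0 (\<lambda>_ r. 1 - r) (a n))"
    by (intro total_rec_rec_nat total_rec_basic total_rec_diff assms)
  ultimately show ?thesis by simp
qed

text \<open>There are exactly \<open>k div 2\<close> odd numbers below \<open>k\<close>, so halving
  is a sum of parities.\<close>

lemma total_rec_half:
  assumes "total_rec a"
  shows "total_rec (\<lambda>n. a n div 2)"
proof -
  have "rec_nat 0 (\<lambda>y r. r + y mod 2) k = k div 2" for k :: nat
    by (induction k) (auto, presburger)
  moreover have "total_rec (\<lambda>n. rec_nat 0 (\<lambda>y r. r + y mod 2) (a n))"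
    by (intro total_rec_rec_nat total_rec_basic total_rec_add total_rec_parity assms)
  ultimately show ?thesis by simp
qed

lemma total_rec_sum_bounded:
  assumes "total_rec2 f" "total_rec b"
  shows "total_rec (\<lambda>n. \<Sum>k<b n. f n k)"
proof -
  have "rec_nat 0 (\<lambda>y r. r + g y) k = (\<Sum>y<k. g y)" for g :: "nat \<Rightarrow> nat" and k
    by (induction k) auto
  moreover have "total_rec (\<lambda>n. rec_nat 0 (\<lambda>y r. r + f n y) (b n))"
    by (intro total_rec_rec_nat total_rec_basic total_rec_add assms
        total_rec2_apply[OF assms(1)])
  ultimately show ?thesis by simp
qed

text \<open>Here the number of summands is fixed, so finitely many additions suffice and
  \<open>f i\<close> may depend on \<open>i\<close> in any way; \<open>total_rec_sum_bounded\<close>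
  instead needs uniformity in the index.\<close>

lemma total_rec_sum:
  fixes N :: nat
  assumes "\<And>i. i < N \<Longrightarrow> total_rec (f i)"
  shows "total_rec (\<lambda>n. \<Sum>i<N. f i n)"
  using assms by (induction N) (auto intro: total_rec_const total_rec_add)

lemma total_rec_list_encode_map:
  assumes "\<And>i. i \<in> set xs \<Longrightarrow> total_rec (f i)"
  shows "total_rec (\<lambda>n. list_encode (map (\<lambda>i. f i n) xs))"
  using assms by (induction xs) (auto intro!: total_rec_basic)


subsection \<open>Access to list codes\<close>

text \<open>A nonempty list is coded as the successor of the pair (head, code of tail), so the tail
  is the second component of the decoded predecessor. The code 0 of the empty list is a fixed point
  of this step.\<close>

definition drop_code :: "nat \<Rightarrow> nat \<Rightarrow> nat" where
  "drop_code k n = rec_nat n (\<lambda>_ r. snd (prod_decode (r - 1))) k"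

text \<open>Positions beyond the end of the list give 0, which is itself the code of the empty list.\<close>

definition nth_code :: "nat \<Rightarrow> nat \<Rightarrow> nat" where
  "nth_code k n = fst (prod_decode (drop_code k n - 1))"

lemma prod_decode_0: "prod_decode 0 = (0, 0)"
  by (simp add: prod_decode_def prod_decode_aux.simps)

lemma total_rec_drop_code:
  "total_rec a \<Longrightarrow> total_rec b \<Longrightarrow> total_rec (\<lambda>n. drop_code (a n) (b n))"
  unfolding drop_code_def
  by (intro total_rec_rec_nat total_rec_basic total_rec_pred)

lemma total_rec_nth_code:
  "total_rec a \<Longrightarrow> total_rec b \<Longrightarrow> total_rec (\<lambda>n. nth_code (a n) (b n))"
  unfolding nth_code_def
  by (intro total_rec_basic total_rec_pred total_rec_drop_code)

lemma drop_code_list_encode: "drop_code k (list_encode xs) = list_encode (drop k xs)"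
proof (induction k)
  case (Suc k)
  then have "drop_code (Suc k) (list_encode xs) = list_encode (tl (drop k xs))"
    by (cases "drop k xs") (auto simp: drop_code_def prod_decode_0)
  then show ?case by (simp add: drop_Suc tl_drop)
qed (simp add: drop_code_def)

lemma nth_code_list_encode:
  "nth_code k (list_encode xs) = (if k < length xs then xs ! k else 0)"
proof (cases "k < length xs")
  case True
  then have "drop k xs = xs ! k # drop (Suc k) xs" by (simp add: Cons_nth_drop_Suc)
  with True show ?thesis by (simp add: nth_code_def drop_code_list_encode)
qed (simp add: nth_code_def drop_code_list_encode prod_decode_0)

lemma nth_code_0: "nth_code k 0 = 0"
  using nth_code_list_encode[of k "[]"] by simp

lemma drop_code_list_encode_eq_0: "drop_code k (list_encode xs) = 0 \<longleftrightarrow> length xs \<le> k"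
  using list_encode_eq[of "drop k xs" "[]"] by (simp add: drop_code_list_encode)

text \<open>This makes the code itself a computable bound for quantifiers and sums over the
  positions of the list.\<close>

lemma length_le_list_encode: "length xs \<le> list_encode xs"
proof (induction xs)
  case (Cons x xs)
  then show ?case using le_prod_encode_2[of "list_encode xs" x] by simp
qed simp


subsection \<open>Decidable predicates\<close>

text \<open>Truth is represented by 0 because \<open>minim\<close> searches for zeros.\<close>

definition decidable_pred :: "(nat \<Rightarrow> bool) \<Rightarrow> bool" where
  "decidable_pred P \<longleftrightarrow> total_rec (\<lambda>n. if P n then 0 else 1)"

lemma decidable_eq_0:
  assumes "total_rec f"
  shows "decidable_pred (\<lambda>n. f n = 0)"
proof -
  have "(if f n = 0 then 0 else 1) = 1 - (1 - f n)" for n by simp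
  moreover have "total_rec (\<lambda>n. 1 - (1 - f n))"
    by (intro total_rec_diff total_rec_const assms)
  ultimately show ?thesis by (simp add: decidable_pred_def)
qed

lemma decidable_not:
  assumes "decidable_pred P"
  shows "decidable_pred (\<lambda>n. \<not> P n)"
proof -
  have "(if \<not> P n then 0 else 1) = 1 - (if P n then 0 else 1 :: nat)" for n by simp
  moreover have "total_rec (\<lambda>n. 1 - (if P n then 0 else 1))"
    using assms by (intro total_rec_diff total_rec_const) (simp add: decidable_pred_def)
  ultimately show ?thesis unfolding decidable_pred_def by presburger
qed

lemma decidable_conj:
  assumes "decidable_pred P" "decidable_pred Q"
  shows "decidable_pred (\<lambda>n. P n \<and> Q n)"
proof -
  have "decidable_pred (\<lambda>n. (if P n then 0 else 1) + (if Q n then 0 else 1 :: nat) = 0)"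
    using assms by (intro decidable_eq_0 total_rec_add) (auto simp: decidable_pred_def)
  moreover have "(if P n then 0 else 1) + (if Q n then 0 else 1 :: nat) = 0 \<longleftrightarrow> P n \<and> Q n" for n
    by auto
  ultimately show ?thesis by simp
qed

lemma decidable_imp:
  assumes "decidable_pred P" "decidable_pred Q"
  shows "decidable_pred (\<lambda>n. P n \<longrightarrow> Q n)"
  using decidable_not[OF decidable_conj[OF assms(1) decidable_not[OF assms(2)]]] by simp

lemma decidable_const: "decidable_pred (\<lambda>_. b)"
  unfolding decidable_pred_def by (rule total_rec_const)

lemma decidable_all_less:
  fixes N :: nat
  assumes "\<And>i. i < N \<Longrightarrow> decidable_pred (P i)"
  shows "decidable_pred (\<lambda>n. \<forall>i<N. P i n)"
  using assms
proof (induction N)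
  case (Suc N)
  then have "decidable_pred (\<lambda>n. (\<forall>i<N. P i n) \<and> P N n)" by (intro decidable_conj) auto
  then show ?case by (simp add: less_Suc_eq all_conj_distrib imp_disjL conj_commute)
qed (simp add: decidable_const)

text \<open>A recursive sum counts the counterexamples below the bound; the quantifier holds iff the
  count is 0.\<close>

lemma decidable_all_bounded:
  assumes P: "decidable_pred (\<lambda>m. P (fst (prod_decode m)) (snd (prod_decode m)))"
    and b: "total_rec b"
  shows "decidable_pred (\<lambda>n. \<forall>k<b n. P n k)"
proof -
  have "decidable_pred (\<lambda>n. (\<Sum>k<b n. if P n k then 0 else 1 :: nat) = 0)"
    using P by (intro decidable_eq_0 total_rec_sum_bounded b)
      (simp add: total_rec2_def decidable_pred_def)
  moreover have "(\<Sum>k<b n. if P n k then 0 else 1 :: nat) = 0 \<longleftrightarrow> (\<forall>k<b n. P n k)" for n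
    by (auto split: if_splits)
  ultimately show ?thesis by (simp only:)
qed

lemma decidable_eq:
  assumes "total_rec f" "total_rec g"
  shows "decidable_pred (\<lambda>n. f n = g n)"
proof -
  have "decidable_pred (\<lambda>n. (f n - g n) + (g n - f n) = 0)"
    by (intro decidable_eq_0 total_rec_add total_rec_diff assms)
  moreover have "(f n - g n) + (g n - f n) = 0 \<longleftrightarrow> f n = g n" for n by auto
  ultimately show ?thesis by (simp only:)
qed

lemma total_rec_indicator:
  assumes "decidable_pred P"
  shows "total_rec (\<lambda>n. if P n then 1 else 0)"
proof -
  have "(\<lambda>n. if P n then 1 else 0) = (\<lambda>n. if \<not> P n then 0 else 1 :: nat)" by auto
  then show ?thesis
    using decidable_not[OF assms] unfolding decidable_pred_def by (simp only:)
qed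


subsection \<open>Recursive functions with rational values\<close>

text \<open>Three natural functions stand for a fraction: a difference as numerator avoids signed
  arithmetic, and a successor as denominator rules out division by zero. The fraction need not be
  reduced.\<close>

definition rat_rec :: "(nat \<Rightarrow> rat) \<Rightarrow> bool" where
  "rat_rec f \<longleftrightarrow> (\<exists>p q r. total_rec p \<and> total_rec q \<and> total_rec r \<and>
     (\<forall>n. f n = (of_nat (p n) - of_nat (q n)) / of_nat (Suc (r n))))"

lemma rat_recI:
  "total_rec p \<Longrightarrow> total_rec q \<Longrightarrow> total_rec r \<Longrightarrow>
    (\<And>n. f n = (of_nat (p n) - of_nat (q n)) / of_nat (Suc (r n))) \<Longrightarrow> rat_rec f"
  unfolding rat_rec_def by blast

lemma rat_rec_mult:
  assumes "rat_rec f" "rat_rec g"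
  shows "rat_rec (\<lambda>n. f n * g n)"
proof -
  from assms obtain p q r p' q' r' where rec: "total_rec p" "total_rec q" "total_rec r"
      "total_rec p'" "total_rec q'" "total_rec r'"
    and f: "\<And>n. f n = (of_nat (p n) - of_nat (q n)) / of_nat (Suc (r n))"
    and g: "\<And>n. g n = (of_nat (p' n) - of_nat (q' n)) / of_nat (Suc (r' n))"
    unfolding rat_rec_def by blast
  show ?thesis
  proof (rule rat_recI)
    \<comment> \<open>The third function is the product of the denominators minus 1, since
      \<open>rat_rec\<close> adds 1 back.\<close>
    show "total_rec (\<lambda>n. p n * p' n + q n * q' n)" "total_rec (\<lambda>n. p n * q' n + q n * p' n)"
      "total_rec (\<lambda>n. Suc (r n) * Suc (r' n) - 1)"
      by (intro total_rec_add total_rec_mult total_rec_pred total_rec_Suc rec)+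
    show "f n * g n = (of_nat (p n * p' n + q n * q' n) - of_nat (p n * q' n + q n * p' n))
        / of_nat (Suc (Suc (r n) * Suc (r' n) - 1))" for n
    proof -
      have "Suc (Suc (r n) * Suc (r' n) - 1) = Suc (r n) * Suc (r' n)" by simp
      then show ?thesis unfolding f g by (simp only:) (simp add: algebra_simps)
    qed
  qed
qed

lemma rat_rec_add:
  assumes "rat_rec f" "rat_rec g"
  shows "rat_rec (\<lambda>n. f n + g n)"
proof -
  from assms obtain p q r p' q' r' where rec: "total_rec p" "total_rec q" "total_rec r"
      "total_rec p'" "total_rec q'" "total_rec r'"
    and f: "\<And>n. f n = (of_nat (p n) - of_nat (q n)) / of_nat (Suc (r n))"
    and g: "\<And>n. g n = (of_nat (p' n) - of_nat (q' n)) / of_nat (Suc (r' n))"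
    unfolding rat_rec_def by blast
  show ?thesis
  proof (rule rat_recI)
    show "total_rec (\<lambda>n. p n * Suc (r' n) + p' n * Suc (r n))"
      "total_rec (\<lambda>n. q n * Suc (r' n) + q' n * Suc (r n))"
      "total_rec (\<lambda>n. Suc (r n) * Suc (r' n) - 1)"
      by (intro total_rec_add total_rec_mult total_rec_pred total_rec_Suc rec)+
    show "f n + g n = (of_nat (p n * Suc (r' n) + p' n * Suc (r n))
        - of_nat (q n * Suc (r' n) + q' n * Suc (r n)))
        / of_nat (Suc (Suc (r n) * Suc (r' n) - 1))" for n
    proof -
      have "Suc (Suc (r n) * Suc (r' n) - 1) = Suc (r n) * Suc (r' n)" by simp
      moreover have "(of_nat (Suc (r n)) :: rat) \<noteq> 0" "(of_nat (Suc (r' n)) :: rat) \<noteq> 0"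
        by (simp_all only: of_nat_eq_0_iff)
      moreover have "(a - b) / y + (c - e) / z = (a * z + c * y - (b * z + e * y)) / (y * z)"
        if "y \<noteq> 0" "z \<noteq> 0" for a b c e y z :: rat
        using that by (simp add: field_simps)
      ultimately show ?thesis unfolding f g by (simp only: of_nat_mult of_nat_add)
    qed
  qed
qed

lemma rat_rec_const_nat: "rat_rec (\<lambda>_. of_nat c)"
  by (rule rat_recI[of "\<lambda>_. c" "\<lambda>_. 0" "\<lambda>_. 0"]) (auto intro: total_rec_const)

lemma rat_rec_sum:
  fixes N :: nat
  assumes "\<And>i. i < N \<Longrightarrow> rat_rec (f i)"
  shows "rat_rec (\<lambda>n. \<Sum>i<N. f i n)"
  using assms
proof (induction N)
  case 0
  then show ?case using rat_rec_const_nat[of 0] by simp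
qed (auto intro: rat_rec_add)

text \<open>Clearing the denominator and moving the negative part across leaves an equation between
  natural numbers. This is why \<open>certifies\<close> writes its right-hand sides with
  \<open>of_nat\<close>.\<close>

lemma decidable_rat_eq_nat:
  assumes "rat_rec f"
  shows "decidable_pred (\<lambda>n. f n = of_nat c)"
proof -
  from assms obtain p q r where rec: "total_rec p" "total_rec q" "total_rec r"
    and f: "\<And>n. f n = (of_nat (p n) - of_nat (q n)) / of_nat (Suc (r n))"
    unfolding rat_rec_def by blast
  have "decidable_pred (\<lambda>n. p n = q n + c * Suc (r n))"
    by (intro decidable_eq total_rec_add total_rec_mult total_rec_const total_rec_Suc rec)
  moreover have "f n = of_nat c \<longleftrightarrow> p n = q n + c * Suc (r n)" for n
  proof -
    have "(of_nat (Suc (r n)) :: rat) \<noteq> 0" by (simp only: of_nat_eq_0_iff)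
    then have "f n = of_nat c \<longleftrightarrow> (of_nat (p n) - of_nat (q n) :: rat) = of_nat (c * Suc (r n))"
      unfolding f by (simp only: divide_eq_eq of_nat_mult) simp
    also have "\<dots> \<longleftrightarrow> (of_nat (p n) :: rat) = of_nat (q n + c * Suc (r n))"
      by (simp only: of_nat_add diff_eq_eq add.commute)
    finally show ?thesis by (simp only: of_nat_eq_iff)
  qed
  ultimately show ?thesis by simp
qed

text \<open>Even codes stand for nonnegative and odd codes for negative integers; the parity factors
  select the right term without a case distinction.\<close>

lemma int_decode_diff:
  "int_decode n = int ((n div 2) * (1 - n mod 2)) - int (Suc (n div 2) * (n mod 2))"
  by (auto simp: int_decode_def sum_decode_def even_iff_mod_2_eq_zero odd_iff_mod_2_eq_one)

lemma rat_rec_int_decode_div: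
  assumes "total_rec a" "total_rec b"
  shows "rat_rec (\<lambda>n. of_int (int_decode (a n)) / of_nat (Suc (b n)))"
proof (rule rat_recI)
  show "total_rec (\<lambda>n. (a n div 2) * (1 - a n mod 2))" "total_rec (\<lambda>n. Suc (a n div 2) * (a n mod 2))"
    by (intro total_rec_mult total_rec_half total_rec_diff total_rec_parity total_rec_Suc
        total_rec_const assms)+
  show "of_int (int_decode (a n)) / of_nat (Suc (b n))
      = (of_nat ((a n div 2) * (1 - a n mod 2)) - of_nat (Suc (a n div 2) * (a n mod 2)) :: rat)
        / of_nat (Suc (b n))" for n
    unfolding int_decode_diff by (simp only: of_int_diff of_int_of_nat_eq)
qed (rule assms)

lemma rat_rec_int_decode: "total_rec a \<Longrightarrow> rat_rec (\<lambda>n. of_int (int_decode (a n)))"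
  using rat_rec_int_decode_div[of a "\<lambda>_. 0"] by (simp add: total_rec_const)

text \<open>The denominator is read as \<open>Suc (b - 1)\<close> to make it nonzero on every number.\<close>

definition rat_decode :: "nat \<Rightarrow> rat" where
  "rat_decode n = of_int (int_decode (fst (prod_decode n))) / of_nat (Suc (snd (prod_decode n) - 1))"

lemma rat_rec_decode: "total_rec a \<Longrightarrow> rat_rec (\<lambda>n. rat_decode (a n))"
  unfolding rat_decode_def
  by (intro rat_rec_int_decode_div total_rec_fst total_rec_snd total_rec_pred)

lemma rat_decode_encode: "rat_decode (rat_encode r) = r"
proof -
  obtain a b where ab: "quotient_of r = (a, b)" by fastforce
  then have b: "b > 0" by (rule quotient_of_denom_pos)
  then have "Suc (nat b - 1) = nat b" by simp
  with ab b show ?thesis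
    using quotient_of_div[OF ab] by (simp add: rat_encode_def rat_decode_def del: of_nat_Suc)
qed

lemma int_decode_0: "int_decode 0 = 0"
  by (simp add: int_decode_def sum_decode_def)

lemma rat_decode_0: "rat_decode 0 = 0"
  by (simp add: rat_decode_def prod_decode_0 int_decode_0)


section \<open>Ranks of abelian groups\<close>

text \<open>Elimination of one coordinate, without division.\<close>

lemma ex_integer_relation:
  fixes v :: "'a \<Rightarrow> 'i \<Rightarrow> int"
  assumes "finite I" "finite A" "card I < card A"
  shows "\<exists>n. (\<exists>a\<in>A. n a \<noteq> 0) \<and> (\<forall>i\<in>I. (\<Sum>a\<in>A. n a * v a i) = 0)"
  using assms
proof (induction I arbitrary: A v rule: finite_induct)
  case empty
  then have "A \<noteq> {}" by auto
  then show ?case by (intro exI[of _ "\<lambda>_. 1"]) auto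
next
  case (insert i0 I)
  show ?case
  proof (cases "\<forall>a\<in>A. v a i0 = 0")
    case True
    moreover obtain n where "\<exists>a\<in>A. n a \<noteq> 0" "\<forall>i\<in>I. (\<Sum>a\<in>A. n a * v a i) = 0"
      using insert.IH[of A v] insert.prems insert.hyps by auto
    ultimately show ?thesis by (intro exI[of _ n]) auto
  next
    case False
    then obtain a0 where a0: "a0 \<in> A" "v a0 i0 \<noteq> 0" by blast
    define A' where "A' = A - {a0}"
    have A': "finite A'" "card I < card A'" "A = insert a0 A'" "a0 \<notin> A'"
      using insert.prems insert.hyps a0 by (auto simp: A'_def)
    obtain n where n: "\<exists>a\<in>A'. n a \<noteq> 0"
        "\<forall>i\<in>I. (\<Sum>a\<in>A'. n a * (v a0 i0 * v a i - v a i0 * v a0 i)) = 0"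
      using insert.IH[of A' "\<lambda>a i. v a0 i0 * v a i - v a i0 * v a0 i"] A' by auto
    \<comment> \<open>The coefficients are scaled by the pivot entry \<open>v a0 i0\<close>, and
      that of \<open>a0\<close> is chosen to cancel coordinate \<open>i0\<close>.\<close>
    define m where "m = (\<lambda>a. if a = a0 then - (\<Sum>b\<in>A'. n b * v b i0) else n a * v a0 i0)"
    have "(\<Sum>a\<in>A. m a * v a i) = (\<Sum>a\<in>A'. n a * (v a0 i0 * v a i - v a i0 * v a0 i))" for i
    proof -
      have "(\<Sum>a\<in>A. m a * v a i) = m a0 * v a0 i + (\<Sum>a\<in>A'. m a * v a i)"
        using A' by simp
      also have "(\<Sum>a\<in>A'. m a * v a i) = (\<Sum>a\<in>A'. n a * v a0 i0 * v a i)"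
        using A' by (intro sum.cong) (auto simp: m_def)
      also have "m a0 * v a0 i = - (\<Sum>a\<in>A'. n a * v a i0 * v a0 i)"
        by (simp add: m_def sum_distrib_right)
      finally show ?thesis
        by (simp add: sum_subtractf[symmetric] algebra_simps)
    qed
    moreover have "\<exists>a\<in>A. m a \<noteq> 0"
      using n(1) a0 A' by (auto simp: m_def)
    ultimately show ?thesis
      using n(2) by (intro exI[of _ m]) auto
  qed
qed

section \<open>Bounding and attaining the rank by means of coordinates\<close>

lemma hom_finprod_comm_group:
  assumes "comm_group G" "comm_group K" "h \<in> hom G K" "finite A" "f \<in> A \<rightarrow> carrier G"
  shows "h (finprod G f A) = finprod K (\<lambda>a. h (f a)) A"
proof -
  interpret G: comm_group G by fact
  interpret K: comm_group K by fact
  interpret h: group_hom G K h by unfold_locales fact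
  show ?thesis
    using assms(4,5) by (induction A rule: finite_induct) (auto simp: Pi_iff)
qed

text \<open>\<open>I\<close> plays the role of a basis of \<open>G\<close> up to torsion, and
  \<open>K\<close> is a quotient of \<open>G\<close>. The two uses are an isomorphism from a sum of
  cyclic groups, with \<open>I\<close> its infinite summands, and the projection from
  \<open>L\<close> to \<open>L/D\<close>, with \<open>I\<close> the pivots.\<close>

locale coordinatized_surjection =
  fixes G :: "('a, 'c) monoid_scheme" and K :: "('b, 'e) monoid_scheme"
    and h :: "'a \<Rightarrow> 'b" and I :: "'i set" and coord :: "'i \<Rightarrow> 'a \<Rightarrow> int"
  assumes comm_G: "comm_group G" and group_K: "group K"
    and hom: "h \<in> hom G K" and surj: "h ` carrier G = carrier K"
    and fin: "finite I"
    and coord_hom: "i \<in> I \<Longrightarrow> coord i \<in> hom G integer_group"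
    and coord_torsion: "\<lbrakk>x \<in> carrier G; \<forall>i\<in>I. coord i x = 0\<rbrakk> \<Longrightarrow>
      \<exists>n::nat. n > 0 \<and> x [^]\<^bsub>G\<^esub> n = \<one>\<^bsub>G\<^esub>"
begin

sublocale G: comm_group G by (rule comm_G)

sublocale h: group_hom G K h
  by (intro group_hom.intro group_hom_axioms.intro hom group_K G.group_axioms)

sublocale K: comm_group K
proof (rule group.group_comm_groupI[OF group_K])
  fix x y assume "x \<in> carrier K" "y \<in> carrier K"
  then obtain a b where "x = h a" "y = h b" "a \<in> carrier G" "b \<in> carrier G"
    using surj by (metis imageE)
  then show "x \<otimes>\<^bsub>K\<^esub> y = y \<otimes>\<^bsub>K\<^esub> x"
    by (metis G.m_comm h.hom_mult)
qed

text \<open>An integer relation among the coordinate vectors gives a product with all coordinates 0,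
  hence of finite order; multiplying the exponents by that order makes the product trivial.\<close>

lemma ex_relation:
  assumes A: "finite A" "card I < card A" and f: "f \<in> A \<rightarrow> carrier G"
  shows "\<exists>n::_ \<Rightarrow> int. (\<exists>a\<in>A. n a \<noteq> 0) \<and> finprod G (\<lambda>a. f a [^]\<^bsub>G\<^esub> n a) A = \<one>\<^bsub>G\<^esub>"
proof -
  obtain n where n: "\<exists>a\<in>A. n a \<noteq> 0" "\<forall>i\<in>I. (\<Sum>a\<in>A. n a * coord i (f a)) = 0"
    using ex_integer_relation[OF fin A, of "\<lambda>a i. coord i (f a)"] by blast
  define x where "x = finprod G (\<lambda>a. f a [^]\<^bsub>G\<^esub> n a) A"
  have carr: "(\<lambda>a. f a [^]\<^bsub>G\<^esub> n a) \<in> A \<rightarrow> carrier G" using f by auto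
  then have x: "x \<in> carrier G" by (simp add: x_def)
  have "coord i x = 0" if i: "i \<in> I" for i
  proof -
    have "coord i x = finprod integer_group (\<lambda>a. coord i (f a [^]\<^bsub>G\<^esub> n a)) A"
      unfolding x_def
      by (rule hom_finprod_comm_group[OF comm_G abelian_integer_group coord_hom[OF i] A(1) carr])
    also have "\<dots> = finprod integer_group (\<lambda>a. n a * coord i (f a)) A"
      using f hom_int_pow[OF coord_hom[OF i] _ G.group_axioms group_integer_group]
      by (intro comm_monoid.finprod_cong' comm_group.axioms(1)[OF abelian_integer_group]) auto
    also have "\<dots> = (\<Sum>a\<in>A. n a * coord i (f a))"
    proof -
      interpret Z: comm_group integer_group by (rule abelian_integer_group)
      show ?thesis using A(1) by (induction A rule: finite_induct) auto
    qed
    finally show ?thesis using n(2) i by simp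
  qed
  then obtain k :: nat where k: "k > 0" "x [^]\<^bsub>G\<^esub> k = \<one>\<^bsub>G\<^esub>"
    using coord_torsion[OF x] by blast
  have pow: "(\<lambda>x. x [^]\<^bsub>G\<^esub> k) \<in> hom G G"
    by (rule homI) (auto simp: G.nat_pow_distrib)
  have "finprod G (\<lambda>a. f a [^]\<^bsub>G\<^esub> (n a * int k)) A = finprod G (\<lambda>a. (f a [^]\<^bsub>G\<^esub> n a) [^]\<^bsub>G\<^esub> k) A"
    using f by (intro G.finprod_cong') (auto simp: G.int_pow_pow simp flip: int_pow_int intro!: G.int_pow_pow[symmetric])
  also have "\<dots> = x [^]\<^bsub>G\<^esub> k"
    unfolding x_def by (rule hom_finprod_comm_group[OF comm_G comm_G pow A(1) carr, symmetric])
  finally have "finprod G (\<lambda>a. f a [^]\<^bsub>G\<^esub> (n a * int k)) A = \<one>\<^bsub>G\<^esub>" using k by simp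
  then show ?thesis using n(1) k(1) by (intro exI[of _ "\<lambda>a. n a * int k"]) auto
qed

text \<open>A larger independent set would lift to \<open>G\<close>, satisfy a relation there by
  \<open>ex_relation\<close>, and \<open>h\<close> would carry this relation back to
  \<open>K\<close>.\<close>

lemma card_independent_le:
  assumes S: "int_independent K S"
  shows "card S \<le> card I"
proof (rule ccontr)
  assume "\<not> ?thesis"
  moreover have fS: "finite S" "S \<subseteq> carrier K" using S by (auto simp: int_independent_def)
  define r where "r = inv_into (carrier G) h"
  have r: "r s \<in> carrier G" "h (r s) = s" if "s \<in> S" for s
    using that fS(2) surj unfolding r_def
    by (metis inv_into_into subsetD, metis f_inv_into_f subsetD)
  ultimately obtain n :: "'b \<Rightarrow> int" where n: "\<exists>s\<in>S. n s \<noteq> 0" "finprod G (\<lambda>s. r s [^]\<^bsub>G\<^esub> n s) S = \<one>\<^bsub>G\<^esub>"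
    using ex_relation[OF fS(1), of r] by force
  have "h (finprod G (\<lambda>s. r s [^]\<^bsub>G\<^esub> n s) S) = finprod K (\<lambda>s. h (r s [^]\<^bsub>G\<^esub> n s)) S"
    using r by (intro hom_finprod_comm_group[OF comm_G K.comm_group_axioms hom fS(1)]) auto
  also have "\<dots> = finprod K (\<lambda>s. s [^]\<^bsub>K\<^esub> n s) S"
    using r fS by (intro K.finprod_cong') (auto simp: h.hom_int_pow)
  finally show False
    using n S by (auto simp: int_independent_def)
qed

text \<open>A nontorsion element of the kernel enlarges every lifted independent set by one.\<close>

lemma card_independent_less:
  assumes S: "int_independent K S"
    and z: "z \<in> carrier G" "h z = \<one>\<^bsub>K\<^esub>" "\<And>n::nat. n > 0 \<Longrightarrow> z [^]\<^bsub>G\<^esub> n \<noteq> \<one>\<^bsub>G\<^esub>"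
  shows "card S < card I"
proof (rule ccontr)
  assume le: "\<not> ?thesis"
  have fS: "finite S" "S \<subseteq> carrier K" using S by (auto simp: int_independent_def)
  define r where "r = inv_into (carrier G) h"
  have r: "r s \<in> carrier G" "h (r s) = s" if "s \<in> S" for s
    using that fS(2) surj unfolding r_def
    by (metis inv_into_into subsetD, metis f_inv_into_f subsetD)
  \<comment> \<open>\<open>None\<close> indexes the kernel element \<open>z\<close> and
    \<open>Some s\<close> the lift of \<open>s\<close>, so the family has one member more than
    \<open>S\<close>.\<close>
  define A where "A = insert None (Some ` S)"
  define f where "f = case_option z r"
  have A: "finite A" "card I < card A"
    using le fS by (auto simp: A_def card_image)
  have f: "f \<in> A \<rightarrow> carrier G" using r z by (auto simp: A_def f_def)
  from ex_relation[OF A f] obtain n :: "'b option \<Rightarrow> int"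
    where n: "\<exists>a\<in>A. n a \<noteq> 0" "finprod G (\<lambda>a. f a [^]\<^bsub>G\<^esub> n a) A = \<one>\<^bsub>G\<^esub>" by blast
  have split: "finprod G (\<lambda>a. f a [^]\<^bsub>G\<^esub> n a) A
      = z [^]\<^bsub>G\<^esub> n None \<otimes>\<^bsub>G\<^esub> finprod G (\<lambda>s. r s [^]\<^bsub>G\<^esub> n (Some s)) S"
  proof -
    have "finprod G (\<lambda>a. f a [^]\<^bsub>G\<^esub> n a) (Some ` S) = finprod G (\<lambda>s. f (Some s) [^]\<^bsub>G\<^esub> n (Some s)) S"
      using r by (intro G.finprod_reindex) (auto simp: f_def)
    moreover have "finprod G (\<lambda>a. f a [^]\<^bsub>G\<^esub> n a) A
        = f None [^]\<^bsub>G\<^esub> n None \<otimes>\<^bsub>G\<^esub> finprod G (\<lambda>a. f a [^]\<^bsub>G\<^esub> n a) (Some ` S)"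
      unfolding A_def using fS r z by (intro G.finprod_insert) (auto simp: f_def)
    ultimately show ?thesis by (simp add: f_def)
  qed
  let ?p = "finprod G (\<lambda>s. r s [^]\<^bsub>G\<^esub> n (Some s)) S"
  have p: "?p \<in> carrier G" using r by (intro G.finprod_closed) auto
  have "h (z [^]\<^bsub>G\<^esub> n None \<otimes>\<^bsub>G\<^esub> ?p) = h ?p"
    using z p by (simp add: h.hom_int_pow)
  also have "h ?p = finprod K (\<lambda>s. h (r s [^]\<^bsub>G\<^esub> n (Some s))) S"
    using r by (intro hom_finprod_comm_group[OF comm_G K.comm_group_axioms hom fS(1)]) auto
  also have "\<dots> = finprod K (\<lambda>s. s [^]\<^bsub>K\<^esub> n (Some s)) S"
    using r fS by (intro K.finprod_cong') (auto simp: h.hom_int_pow)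
  finally have "finprod K (\<lambda>s. s [^]\<^bsub>K\<^esub> n (Some s)) S = \<one>\<^bsub>K\<^esub>"
    using n(2) split h.hom_one by simp
  then have n0: "\<forall>s\<in>S. n (Some s) = 0"
    using S unfolding int_independent_def by (elim conjE) (erule allE[of _ "\<lambda>s. n (Some s)"], simp)
  then have "?p = \<one>\<^bsub>G\<^esub>" by (intro G.finprod_one_eqI) auto
  then have zn: "z [^]\<^bsub>G\<^esub> n None = \<one>\<^bsub>G\<^esub>" using n split z by simp
  have "n None \<noteq> 0" using n(1) n0 by (auto simp: A_def)
  moreover have "z [^]\<^bsub>G\<^esub> nat \<bar>n None\<bar> = \<one>\<^bsub>G\<^esub>"
  proof (cases "n None \<ge> 0")
    case True
    then show ?thesis using zn by (simp flip: int_pow_int)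
  next
    case False
    then have "z [^]\<^bsub>G\<^esub> nat \<bar>n None\<bar> = z [^]\<^bsub>G\<^esub> (- n None)"
      by (simp flip: int_pow_int)
    then show ?thesis using zn z by (simp add: G.int_pow_neg)
  qed
  ultimately show False using z(3)[of "nat \<bar>n None\<bar>"] by simp
qed

text \<open>The bound of \<open>card_independent_le\<close> makes the \<open>GREATEST\<close> in
  \<open>ab_rank\<close> an attained maximum, and the strict bound applies to a set attaining
  it.\<close>

lemma ab_rank_less:
  assumes "z \<in> carrier G" "h z = \<one>\<^bsub>K\<^esub>" "\<And>n::nat. n > 0 \<Longrightarrow> z [^]\<^bsub>G\<^esub> n \<noteq> \<one>\<^bsub>G\<^esub>"
  shows "ab_rank K < card I"
proof -
  have "int_independent K {}" by (auto simp: int_independent_def)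
  then have "\<exists>S. int_independent K S \<and> card S = ab_rank K"
    unfolding ab_rank_def
    by (intro GreatestI_nat[where P = "\<lambda>r. \<exists>S. int_independent K S \<and> card S = r" and b = "card I" and k = 0])
      (use card_independent_le in auto)
  then show ?thesis using card_independent_less[OF _ assms] by metis
qed

text \<open>Coordinates that form a diagonal matrix with nonzero entries force every exponent of a
  relation to vanish. Entries other than 1 are allowed because integral vectors of \<open>L\<close>
  arise by clearing denominators.\<close>

lemma ab_rank_eq:
  assumes inj: "inj_on h (carrier G)"
    and g: "\<And>i. i \<in> I \<Longrightarrow> g i \<in> carrier G"
      "\<And>i l. i \<in> I \<Longrightarrow> l \<in> I \<Longrightarrow> coord l (g i) = (if i = l then m i else 0)"
      "\<And>i. i \<in> I \<Longrightarrow> m i \<noteq> 0"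
  shows "ab_rank K = card I"
proof -
  define f where "f i = h (g i)" for i
  \<comment> \<open>\<open>int_independent\<close> concerns sets, so the images must be distinct for
    the cardinality to be right; the diagonal coordinates separate them.\<close>
  have fI: "inj_on f I"
  proof (rule inj_onI)
    fix i j assume ij: "i \<in> I" "j \<in> I" "f i = f j"
    then have "g i = g j" using inj g(1) by (auto simp: f_def dest: inj_onD)
    then have "coord i (g j) = m i" using g(2)[of i i] ij by simp
    then show "i = j" using g(2)[of j i] g(3)[of i] ij by argo
  qed
  have "int_independent K (f ` I)"
    unfolding int_independent_def
  proof (intro conjI allI impI)
    show "f ` I \<subseteq> carrier K" using g(1) by (auto simp: f_def)
    fix n :: "'b \<Rightarrow> int"
    assume *: "finprod K (\<lambda>s. s [^]\<^bsub>K\<^esub> n s) (f ` I) = \<one>\<^bsub>K\<^esub>"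
    define x where "x = finprod G (\<lambda>i. g i [^]\<^bsub>G\<^esub> n (f i)) I"
    have carr: "(\<lambda>i. g i [^]\<^bsub>G\<^esub> n (f i)) \<in> I \<rightarrow> carrier G" using g(1) by auto
    have x: "x \<in> carrier G" unfolding x_def using carr by simp
    have "h x = finprod K (\<lambda>i. h (g i [^]\<^bsub>G\<^esub> n (f i))) I"
      unfolding x_def by (rule hom_finprod_comm_group[OF comm_G K.comm_group_axioms hom fin carr])
    also have "\<dots> = finprod K (\<lambda>i. f i [^]\<^bsub>K\<^esub> n (f i)) I"
      using g(1) by (intro K.finprod_cong') (auto simp: h.hom_int_pow f_def)
    also have "\<dots> = finprod K (\<lambda>s. s [^]\<^bsub>K\<^esub> n s) (f ` I)"
      using g(1) by (intro K.finprod_reindex[symmetric] fI) (auto simp: f_def)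
    finally have "h x = h \<one>\<^bsub>G\<^esub>" using * by simp
    then have x1: "x = \<one>\<^bsub>G\<^esub>" using inj x by (meson G.one_closed inj_onD)
    have "n (f l) = 0" if l: "l \<in> I" for l
    proof -
      interpret Z: comm_group integer_group by (rule abelian_integer_group)
      interpret c: group_hom G integer_group "coord l"
        using coord_hom[OF l] by unfold_locales
      have "coord l x = finprod integer_group (\<lambda>i. coord l (g i [^]\<^bsub>G\<^esub> n (f i))) I"
        unfolding x_def
        by (rule hom_finprod_comm_group[OF comm_G abelian_integer_group coord_hom[OF l] fin carr])
      also have "\<dots> = finprod integer_group (\<lambda>i. if i = l then n (f l) * m l else 0) I"
        using g l by (intro Z.finprod_cong') (auto simp: c.hom_int_pow)
      also have "\<dots> = (\<Sum>i\<in>I. if i = l then n (f l) * m l else 0)"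
        using fin by (induction I rule: finite_induct) auto
      also have "\<dots> = n (f l) * m l" using fin l by simp
      finally show ?thesis using x1 g(3)[OF l] c.hom_one by simp
    qed
    then show "\<forall>s\<in>f ` I. n s = 0" by auto
  qed (use fin in auto)
  moreover have "card (f ` I) = card I" by (rule card_image[OF fI])
  ultimately show ?thesis
    unfolding ab_rank_def
    by (intro Greatest_equality) (auto dest: card_independent_le)
qed

end

text \<open>An element whose components at the infinite summands vanish lies in the finite part and
  is torsion, and the unit vectors at the infinite summands are independent.\<close>

lemma ab_rank_iso_cyclic_sum:
  assumes "group K" "K \<cong> cyclic_sum ns"
  shows "ab_rank K = card {i. i < length ns \<and> ns ! i = 0}"
proof -
  let ?G = "cyclic_sum ns" and ?I = "{i. i < length ns \<and> ns ! i = 0}"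
  have group: "group ?G" by (simp add: cyclic_sum_def)
  have comm: "comm_group ?G"
    by (rule group.group_comm_groupI[OF group]) (auto simp: cyclic_sum_def add.commute)
  \<comment> \<open>As \<open>mod\<close> 0 is the identity, the same formula covers the infinite
    summands.\<close>
  have pow: "(x [^]\<^bsub>?G\<^esub> k) i = (int k * x i) mod int (ns ! i)"
    if "x \<in> carrier ?G" "i < length ns" for x i and k :: nat
  proof (induction k)
    case (Suc k)
    have "(x [^]\<^bsub>?G\<^esub> Suc k) i = ((x [^]\<^bsub>?G\<^esub> k) i + x i) mod int (ns ! i)"
      using that(2) by (simp add: nat_pow_def cyclic_sum_def)
    then show ?case unfolding Suc.IH by (simp add: mod_simps algebra_simps)
  qed (use that in \<open>simp add: nat_pow_def cyclic_sum_def\<close>)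
  obtain h where h: "h \<in> iso ?G K"
    using assms(2) group.iso_sym[OF assms(1)] by (auto simp: is_iso_def)
  interpret coordinatized_surjection ?G K h ?I "\<lambda>i x. x i"
  proof (rule coordinatized_surjection.intro)
    show "h \<in> hom ?G K" "h ` carrier ?G = carrier K"
      using h by (auto simp: iso_def bij_betw_def)
    show "(\<lambda>x. x i) \<in> hom ?G integer_group" if "i \<in> ?I" for i
      using that by (intro homI) (auto simp: cyclic_sum_def)
    fix x assume x: "x \<in> carrier ?G" "\<forall>i\<in>?I. x i = 0"
    \<comment> \<open>The product of the nonzero orders annihilates every finite summand; omitting
      the zeros keeps it positive.\<close>
    define k where "k = prod_list (filter (\<lambda>n. n \<noteq> 0) ns)"
    have "k > 0" by (auto simp: k_def prod_list_zero_iff intro!: gr0I)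
    moreover have "x [^]\<^bsub>?G\<^esub> k = \<one>\<^bsub>?G\<^esub>"
    proof (rule PiE_ext)
      show "x [^]\<^bsub>?G\<^esub> k \<in> (\<Pi>\<^sub>E i\<in>{..<length ns}. UNIV)" "\<one>\<^bsub>?G\<^esub> \<in> (\<Pi>\<^sub>E i\<in>{..<length ns}. UNIV)"
        using monoid.nat_pow_closed[OF group.is_monoid[OF group] x(1), of k]
        by (auto simp: cyclic_sum_def PiE_iff)
      fix i assume i: "i \<in> {..<length ns}"
      show "(x [^]\<^bsub>?G\<^esub> k) i = \<one>\<^bsub>?G\<^esub> i"
      proof (cases "ns ! i = 0")
        case True
        then show ?thesis using i x pow by (auto simp: cyclic_sum_def)
      next
        case False
        then have "ns ! i \<in> set (filter (\<lambda>n. n \<noteq> 0) ns)" using i by auto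
        then have "ns ! i dvd k" unfolding k_def by (rule prod_list_dvd)
        then have "int (ns ! i) dvd int k * x i" by (simp add: dvd_mult2)
        then show ?thesis using i x pow by (auto simp: cyclic_sum_def)
      qed
    qed
    ultimately show "\<exists>n::nat. n > 0 \<and> x [^]\<^bsub>?G\<^esub> n = \<one>\<^bsub>?G\<^esub>" by blast
  qed (use comm assms in auto)
  show ?thesis
  proof (rule ab_rank_eq[of "\<lambda>i. \<lambda>j\<in>{..<length ns}. if j = i then 1 else 0" "\<lambda>_. 1"])
    show "inj_on h (carrier ?G)" using h by (auto simp: iso_def bij_betw_def)
  qed (auto simp: cyclic_sum_def integer_mod_group_def PiE_iff)
qed


section \<open>Certificates for kernels\<close>

text \<open>Gauss-Jordan elimination, by induction on the coordinates, for a family that may be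
  infinite. \<open>J\<close> is the set of pivots, \<open>K j\<close> the family member chosen for
  pivot \<open>j\<close>, and \<open>x\<close> records the reduced vectors \<open>g\<close> as
  combinations of the chosen members. That record holds at every coordinate, not only on
  \<open>E\<close>, so that it survives the passage to further coordinates.\<close>

lemma ex_pivots:
  fixes V :: "'t \<Rightarrow> 'i \<Rightarrow> rat"
  assumes "finite E"
  shows "\<exists>J K x g. J \<subseteq> E \<and> (\<forall>j\<in>J. K j \<in> T) \<and> (\<forall>j\<in>J. \<forall>p. g j p = (\<Sum>i\<in>J. x j i * V (K i) p))
    \<and> (\<forall>j\<in>J. \<forall>l\<in>J. g j l = of_bool (j = l)) \<and> (\<forall>t\<in>T. \<forall>p\<in>E. V t p = (\<Sum>j\<in>J. V t j * g j p))"
  using assms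
proof (induction E rule: finite_induct)
  case empty
  show ?case by (rule exI[of _ "{}"]) auto
next
  case (insert p E)
  from insert.IH obtain J K x g where J: "J \<subseteq> E" and K: "\<forall>j\<in>J. K j \<in> T"
    and gx: "\<forall>j\<in>J. \<forall>p. g j p = (\<Sum>i\<in>J. x j i * V (K i) p)"
    and delta: "\<forall>j\<in>J. \<forall>l\<in>J. g j l = of_bool (j = l)"
    and V: "\<forall>t\<in>T. \<forall>p\<in>E. V t p = (\<Sum>j\<in>J. V t j * g j p)"
    by (elim exE conjE) (rule that)
  have fJ: "finite J" using J insert.hyps finite_subset by blast
  have pJ: "p \<notin> J" using J insert.hyps by auto
  show ?case
  proof (cases "\<forall>t\<in>T. V t p = (\<Sum>j\<in>J. V t j * g j p)")
    case True
    then have "\<forall>t\<in>T. \<forall>q\<in>insert p E. V t q = (\<Sum>j\<in>J. V t j * g j q)" using V by blast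
    moreover have "J \<subseteq> insert p E" using J by blast
    ultimately show ?thesis using K gx delta
      by (intro exI[of _ J] exI[of _ K] exI[of _ x] exI[of _ g] conjI)
  next
    case False
    then obtain t0 where t0: "t0 \<in> T" "V t0 p \<noteq> (\<Sum>j\<in>J. V t0 j * g j p)" by blast
    \<comment> \<open>The defect of \<open>V t0\<close> at the new coordinate; as it is nonzero,
      \<open>p\<close> becomes a pivot.\<close>
    define r where "r = V t0 p - (\<Sum>j\<in>J. V t0 j * g j p)"
    have r: "r \<noteq> 0" using t0 by (simp add: r_def)
    \<comment> \<open>The remainder of \<open>V t0\<close> after the old pivots, scaled to 1 at
      \<open>p\<close>. It vanishes on \<open>E\<close> by the induction hypothesis, so subtracting
      multiples of it to clear \<open>p\<close> from the old \<open>g j\<close> disturbs nothing on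
      \<open>E\<close>.\<close>
    define gp where "gp q = (V t0 q - (\<Sum>j\<in>J. V t0 j * g j q)) / r" for q
    define xp where "xp i = (if i = p then 1 / r else - (\<Sum>j\<in>J. V t0 j * x j i) / r)" for i
    define K' where "K' = K(p := t0)"
    define g' where "g' j q = (if j = p then gp q else g j q - g j p * gp q)" for j q
    define x' where "x' j i = (if j = p then xp i else (if i = p then 0 else x j i) - g j p * xp i)" for j i
    have gpE: "gp q = 0" if "q \<in> E" for q using V t0 that by (simp add: gp_def)
    have gpp: "gp p = 1" using r by (simp add: gp_def r_def[symmetric])
    have K'J: "(\<Sum>i\<in>J. f i * V (K' i) q) = (\<Sum>i\<in>J. f i * V (K i) q)" for f q
      using pJ by (intro sum.cong) (auto simp: K'_def)
    have gpx: "gp q = (\<Sum>i\<in>insert p J. xp i * V (K' i) q)" for q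
    proof -
      have "(\<Sum>j\<in>J. V t0 j * g j q) = (\<Sum>j\<in>J. \<Sum>i\<in>J. V t0 j * x j i * V (K i) q)"
        using gx by (simp add: sum_distrib_left mult.assoc)
      also have "\<dots> = (\<Sum>i\<in>J. (\<Sum>j\<in>J. V t0 j * x j i) * V (K i) q)"
        by (subst sum.swap) (simp add: sum_distrib_right)
      also have "\<dots> = (\<Sum>i\<in>J. - r * (xp i * V (K i) q))"
        using pJ r by (intro sum.cong) (auto simp: xp_def)
      also have "\<dots> = - r * (\<Sum>i\<in>J. xp i * V (K i) q)"
        by (rule sum_distrib_left[symmetric])
      finally have eq: "(\<Sum>j\<in>J. V t0 j * g j q) = - r * (\<Sum>i\<in>J. xp i * V (K i) q)" .
      have "(\<Sum>i\<in>insert p J. xp i * V (K' i) q) = V t0 q / r + (\<Sum>i\<in>J. xp i * V (K i) q)"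
        using fJ pJ K'J by (simp add: xp_def K'_def)
      then show ?thesis unfolding gp_def eq using r by (simp add: diff_divide_distrib add_divide_distrib)
    qed
    have g'x: "g' j q = (\<Sum>i\<in>insert p J. x' j i * V (K' i) q)" if j: "j \<in> insert p J" for j q
    proof (cases "j = p")
      case True
      then show ?thesis using gpx by (simp add: g'_def x'_def)
    next
      case False
      then have "g j q = (\<Sum>i\<in>insert p J. (if i = p then 0 else x j i) * V (K' i) q)"
      proof -
        have "(\<Sum>i\<in>J. (if i = p then 0 else x j i) * V (K' i) q) = (\<Sum>i\<in>J. x j i * V (K i) q)"
          using pJ by (intro sum.cong) (auto simp: K'_def)
        then show ?thesis using False j gx fJ pJ by simp
      qed
      with False show ?thesis
        by (simp only: g'_def x'_def gpx if_False left_diff_distrib sum_subtractf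
            sum_distrib_left mult.assoc)
    qed
    have V': "V t q = (\<Sum>j\<in>insert p J. V t j * g' j q)" if t: "t \<in> T" and q: "q \<in> insert p E" for t q
    proof (cases "q = p")
      case True
      have "(\<Sum>j\<in>J. V t j * g' j p) = 0"
        using pJ by (intro sum.neutral) (auto simp: g'_def gpp)
      then show ?thesis using True fJ pJ by (simp add: g'_def gpp)
    next
      case False
      then have q: "q \<in> E" using q by simp
      have "(\<Sum>j\<in>J. V t j * g' j q) = (\<Sum>j\<in>J. V t j * g j q)"
        using pJ gpE[OF q] by (intro sum.cong) (auto simp: g'_def)
      then show ?thesis using fJ pJ V t q gpE[OF q] by (simp add: g'_def)
    qed
    show ?thesis
    proof (intro exI conjI)
      show "insert p J \<subseteq> insert p E" using J by blast
      show "\<forall>j\<in>insert p J. K' j \<in> T" using K t0 by (auto simp: K'_def)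
      show "\<forall>j\<in>insert p J. \<forall>q. g' j q = (\<Sum>i\<in>insert p J. x' j i * V (K' i) q)"
        by (intro ballI allI g'x)
      show "\<forall>j\<in>insert p J. \<forall>l\<in>insert p J. g' j l = of_bool (j = l)"
        using delta gpE gpp J pJ by (auto simp: g'_def)
      show "\<forall>t\<in>T. \<forall>q\<in>insert p E. V t q = (\<Sum>j\<in>insert p J. V t j * g' j q)"
        by (intro ballI V')
    qed
  qed
qed

lemma ex_common_denominator:
  fixes f :: "'a \<Rightarrow> rat"
  assumes "finite A"
  shows "\<exists>m::int. m > 0 \<and> (\<forall>a\<in>A. of_int m * f a \<in> \<int>)"
  using assms
proof (induction A rule: finite_induct)
  case empty
  show ?case by (rule exI[of _ 1]) auto
next
  case (insert a A)
  then obtain m :: int where m: "m > 0" "\<forall>a\<in>A. of_int m * f a \<in> \<int>" by blast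
  obtain b c where bc: "quotient_of (f a) = (b, c)" by fastforce
  then have c: "c > 0" "f a = of_int b / of_int c"
    using quotient_of_denom_pos quotient_of_div by blast+
  have "of_int (m * c) * f a' \<in> \<int>" if "a' \<in> insert a A" for a'
  proof (cases "a' = a")
    case True
    then have "of_int (m * c) * f a' = of_int (m * b)" using c by simp
    then show ?thesis by (simp only: Ints_of_int)
  next
    case False
    have "of_int (m * c) * f a' = of_int c * (of_int m * f a')" by simp
    moreover have "of_int m * f a' \<in> \<int>" using m(2) that False by auto
    ultimately show ?thesis using Ints_mult[OF Ints_of_int] by metis
  qed
  then show ?case using m c by (intro exI[of _ "m * c"]) auto
qed

section \<open>Reading and checking certificates\<close>

definition vec_entry :: "nat \<Rightarrow> nat \<Rightarrow> nat \<Rightarrow> rat" where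
  "vec_entry n t l = rat_decode (nth_code l (nth_code t n))"

definition pivot :: "nat \<Rightarrow> nat \<Rightarrow> bool" where
  "pivot w i \<longleftrightarrow> nth_code i (nth_code 0 w) \<noteq> 0"

text \<open>The matrix is stored by columns, because \<open>map_code\<close> lists the images of the
  basis vectors.\<close>

definition mat_entry :: "nat \<Rightarrow> nat \<Rightarrow> nat \<Rightarrow> int" where
  "mat_entry w r k = int_decode (nth_code r (nth_code k (nth_code 1 w)))"

definition comb_entry :: "nat \<Rightarrow> nat \<Rightarrow> nat \<Rightarrow> rat" where
  "comb_entry w j i = rat_decode (nth_code i (nth_code j (nth_code 2 w)))"

text \<open>One input vector per pivot suffices. Selecting at most \<open>N\<close> of them keeps
  the combinations at a fixed length while the number of input vectors varies.\<close>

definition comb_index :: "nat \<Rightarrow> nat \<Rightarrow> nat" where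
  "comb_index w i = nth_code i (nth_code 3 w)"

text \<open>Let \<open>n\<close> encode vectors \<open>u\<^sub>0, u\<^sub>1, \<dots>\<close> in \<open>\<rat>\<^sup>N\<close>. A certificate \<open>w\<close> consists of an integer matrix
  killing all \<open>u\<^sub>t\<close>, a set of pivots, and for each pivot \<open>j\<close> a combination of the \<open>u\<^sub>t\<close> whose pivot
  coordinates are those of \<open>e\<^sub>j\<close>. The shape of the nonpivot rows makes a vector of the kernel
  determined by its pivot coordinates, so that the \<open>u\<^sub>t\<close> span the kernel and its dimension is the
  number of pivots.\<close>

definition certifies :: "nat \<Rightarrow> nat \<Rightarrow> nat \<Rightarrow> bool" where
  "certifies N n w \<longleftrightarrow>
     (\<forall>t<n. \<forall>r<N. (\<Sum>k<N. of_int (mat_entry w r k) * vec_entry n t k) = of_nat 0)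
   \<and> (\<forall>j<N. \<forall>l<N. pivot w j \<and> pivot w l \<longrightarrow>
        (\<Sum>i<N. comb_entry w j i * vec_entry n (comb_index w i) l) = of_nat (of_bool (j = l)))
   \<and> (\<forall>p<N. \<not> pivot w p \<longrightarrow> mat_entry w p p \<noteq> 0 \<and>
        (\<forall>k<N. \<not> pivot w k \<and> k \<noteq> p \<longrightarrow> mat_entry w p k = 0))"

lemma decidable_pivot: "total_rec w \<Longrightarrow> decidable_pred (\<lambda>n. pivot (w n) i)"
  unfolding pivot_def
  by (intro decidable_not decidable_eq_0 total_rec_nth_code total_rec_const)

lemma decidable_mat_entry: "total_rec w \<Longrightarrow> decidable_pred (\<lambda>n. mat_entry (w n) r k = 0)"
proof -
  have "mat_entry w r k = 0 \<longleftrightarrow> nth_code r (nth_code k (nth_code 1 w)) = 0" for w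
    unfolding mat_entry_def by (metis int_decode_0 int_decode_eq)
  then show "total_rec w \<Longrightarrow> ?thesis"
    by (simp only:) (intro decidable_eq_0 total_rec_nth_code total_rec_const)
qed

lemma rat_rec_mat_entry: "total_rec w \<Longrightarrow> rat_rec (\<lambda>n. of_int (mat_entry (w n) r k))"
  unfolding mat_entry_def by (intro rat_rec_int_decode total_rec_nth_code total_rec_const)

lemma rat_rec_comb_entry: "total_rec w \<Longrightarrow> rat_rec (\<lambda>n. comb_entry (w n) j i)"
  unfolding comb_entry_def by (intro rat_rec_decode total_rec_nth_code total_rec_const)

lemma total_rec_comb_index: "total_rec w \<Longrightarrow> total_rec (\<lambda>n. comb_index (w n) i)"
  unfolding comb_index_def by (intro total_rec_nth_code total_rec_const)

lemma rat_rec_vec_entry: "total_rec a \<Longrightarrow> total_rec t \<Longrightarrow> rat_rec (\<lambda>n. vec_entry (a n) (t n) l)"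
  unfolding vec_entry_def by (intro rat_rec_decode total_rec_nth_code total_rec_const)

text \<open>All sums and quantifiers have the fixed range \<open>N\<close>, except the one over the
  input vectors, which is bounded by the code.\<close>

lemma decidable_certifies:
  "decidable_pred (\<lambda>m. certifies N (fst (prod_decode m)) (snd (prod_decode m)))"
proof -
  note rec = decidable_rat_eq_nat rat_rec_sum rat_rec_mult rat_rec_mat_entry rat_rec_comb_entry
    rat_rec_vec_entry total_rec_comb_index total_rec_fst total_rec_snd total_rec_id
  note dec = decidable_all_less decidable_imp decidable_conj decidable_not decidable_const
    decidable_pivot decidable_mat_entry
  have 1: "decidable_pred (\<lambda>m. \<forall>t<fst (prod_decode m). \<forall>r<N.
      (\<Sum>k<N. of_int (mat_entry (snd (prod_decode m)) r k) * vec_entry (fst (prod_decode m)) t k) = of_nat 0)"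
    by (rule decidable_all_bounded) (rule decidable_all_less, intro rec, rule total_rec_fst_decode)
  have 2: "decidable_pred (\<lambda>m. \<forall>j<N. \<forall>l<N. pivot (snd (prod_decode m)) j \<and> pivot (snd (prod_decode m)) l \<longrightarrow>
        (\<Sum>i<N. comb_entry (snd (prod_decode m)) j i *
          vec_entry (fst (prod_decode m)) (comb_index (snd (prod_decode m)) i) l) = of_nat (of_bool (j = l)))"
    by (rule decidable_all_less)+ (rule decidable_imp, intro decidable_conj decidable_pivot rec, intro rec)
  have 3: "decidable_pred (\<lambda>m. \<forall>p<N. \<not> pivot (snd (prod_decode m)) p \<longrightarrow>
      mat_entry (snd (prod_decode m)) p p \<noteq> 0 \<and>
        (\<forall>k<N. \<not> pivot (snd (prod_decode m)) k \<and> k \<noteq> p \<longrightarrow> mat_entry (snd (prod_decode m)) p k = 0))"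
    by (intro dec total_rec_snd_decode)
  show ?thesis
    unfolding certifies_def by (rule decidable_conj[OF 1 decidable_conj[OF 2 3]])
qed

text \<open>Justifies the bound \<open>t < n\<close> in \<open>certifies\<close>: the list is no
  longer than its code, and absent vectors are read as 0.\<close>

lemma vec_entry_beyond: "n \<le> t \<Longrightarrow> vec_entry n t l = 0"
proof -
  assume "n \<le> t"
  moreover have "length (list_decode n) \<le> n"
    using length_le_list_encode[of "list_decode n"] by simp
  ultimately have "nth_code t n = 0"
    using nth_code_list_encode[of t "list_decode n"] by simp
  then show ?thesis by (simp add: vec_entry_def nth_code_0 rat_decode_0)
qed

lemma certifies_kernelD:
  assumes "certifies N n w" "r < N"
  shows "(\<Sum>k<N. of_int (mat_entry w r k) * vec_entry n t k) = 0"
  using assms vec_entry_beyond[of n t] by (cases "t < n") (auto simp: certifies_def)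

text \<open>Once the pivot coordinates are 0, row \<open>l\<close> of a nonpivot reduces to its
  diagonal term, whose coefficient is nonzero.\<close>

lemma certifies_pivots_determine:
  assumes cert: "certifies N n w"
    and q: "\<And>r. r < N \<Longrightarrow> (\<Sum>k<N. of_int (mat_entry w r k) * q k) = (0::rat)"
    and zero: "\<And>j. j < N \<Longrightarrow> pivot w j \<Longrightarrow> q j = 0"
    and l: "l < N"
  shows "q l = 0"
proof (cases "pivot w l")
  case False
  have "(\<Sum>k<N. of_int (mat_entry w l k) * q k) = (\<Sum>k<N. if k = l then of_int (mat_entry w l l) * q l else 0)"
  proof (rule sum.cong)
    fix k assume "k \<in> {..<N}"
    then show "of_int (mat_entry w l k) * q k = (if k = l then of_int (mat_entry w l l) * q l else 0)"
      using cert zero[of k] False l unfolding certifies_def by (cases "pivot w k") auto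
  qed simp
  also have "\<dots> = of_int (mat_entry w l l) * q l" using l by simp
  finally show ?thesis using q[OF l] cert False l by (simp add: certifies_def)
qed (use zero l in auto)

definition comb_vec :: "nat \<Rightarrow> nat \<Rightarrow> nat \<Rightarrow> nat \<Rightarrow> nat \<Rightarrow> rat" where
  "comb_vec N n w j l = (\<Sum>i<N. comb_entry w j i * vec_entry n (comb_index w i) l)"

lemma comb_vec_pivot:
  assumes "certifies N n w" "j < N" "l < N" "pivot w j" "pivot w l"
  shows "comb_vec N n w j l = of_bool (j = l)"
  using assms by (simp add: certifies_def comb_vec_def)

lemma comb_vec_kernel:
  assumes "certifies N n w" "r < N"
  shows "(\<Sum>k<N. of_int (mat_entry w r k) * comb_vec N n w j k) = 0"
proof -
  have "(\<Sum>k<N. of_int (mat_entry w r k) * comb_vec N n w j k)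
      = (\<Sum>i<N. comb_entry w j i * (\<Sum>k<N. of_int (mat_entry w r k) * vec_entry n (comb_index w i) k))"
    unfolding comb_vec_def sum_distrib_left by (subst sum.swap) (simp add: ac_simps)
  then show ?thesis using certifies_kernelD[OF assms] by simp
qed

text \<open>Subtracting the combination with the pivot coordinates of \<open>q\<close> as
  coefficients leaves a kernel vector with zero pivot coordinates, which vanishes.\<close>

lemma certifies_kernel_span:
  assumes cert: "certifies N n w"
    and q: "\<And>r. r < N \<Longrightarrow> (\<Sum>k<N. of_int (mat_entry w r k) * q k) = (0::rat)"
    and l: "l < N"
  shows "q l = (\<Sum>j\<in>{j. j < N \<and> pivot w j}. q j * comb_vec N n w j l)"
proof -
  let ?J = "{j. j < N \<and> pivot w j}"
  define q' where "q' k = q k - (\<Sum>j\<in>?J. q j * comb_vec N n w j k)" for k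
  have "q' l = 0"
  proof (rule certifies_pivots_determine[OF cert _ _ l])
    fix r assume r: "r < N"
    have "(\<Sum>k<N. of_int (mat_entry w r k) * (\<Sum>j\<in>?J. q j * comb_vec N n w j k))
        = (\<Sum>j\<in>?J. q j * (\<Sum>k<N. of_int (mat_entry w r k) * comb_vec N n w j k))"
      unfolding sum_distrib_left by (subst sum.swap) (simp add: ac_simps)
    also have "\<dots> = 0" using comb_vec_kernel[OF cert r] by simp
    finally show "(\<Sum>k<N. of_int (mat_entry w r k) * q' k) = 0"
      using q[OF r] by (simp add: q'_def right_diff_distrib sum_subtractf)
  next
    fix i assume i: "i < N" "pivot w i"
    have "(\<Sum>j\<in>?J. q j * comb_vec N n w j i) = (\<Sum>j\<in>?J. if j = i then q i else 0)"
      using i by (intro sum.cong) (auto simp: comb_vec_pivot[OF cert])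
    also have "\<dots> = q i" using i by simp
    finally show "q' i = 0" by (simp add: q'_def)
  qed
  then show ?thesis by (simp add: q'_def)
qed

text \<open>Guarantees termination of the search. The data come from \<open>ex_pivots\<close>
  applied to all vectors that \<open>vec_entry\<close> reads from \<open>n\<close>.\<close>

lemma ex_certificate: "\<exists>w. certifies N n w"
proof -
  obtain J K x g where J: "J \<subseteq> {..<N}"
    and gx: "\<forall>j\<in>J. \<forall>p. g j p = (\<Sum>i\<in>J. x j i * vec_entry n (K i) p)"
    and delta: "\<forall>j\<in>J. \<forall>l\<in>J. g j l = of_bool (j = l)"
    and V: "\<forall>t. \<forall>p\<in>{..<N}. vec_entry n t p = (\<Sum>j\<in>J. vec_entry n t j * g j p)"
    using ex_pivots[of "{..<N}" UNIV "vec_entry n"] by auto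
  have fJ: "finite J" using J finite_subset by blast
  obtain m :: int where m: "m > 0" "\<forall>a\<in>J \<times> {..<N}. of_int m * (\<lambda>(j, p). g j p) a \<in> \<int>"
    using ex_common_denominator[of "J \<times> {..<N}" "\<lambda>(j, p). g j p"] fJ by auto
  \<comment> \<open>A nonpivot row \<open>r\<close> states q_r = sum of q_k g_k(r) over the pivots
    k, multiplied by \<open>m\<close> to become integral, so the floor is exact. Pivot rows are
    0.\<close>
  define B where "B r k = (if r \<in> J then 0 else if k = r then m
      else if k \<in> J then - \<lfloor>of_int m * g k r\<rfloor> else 0)" for r k
  \<comment> \<open>Zero coefficients off \<open>J\<close> turn sums over all \<open>i < N\<close>
    into sums over the pivots.\<close>
  define X where "X j i = (if i \<in> J then x j i else 0)" for j i
  define w where "w = list_encode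
    [list_encode (map (\<lambda>i. if i \<in> J then 1 else 0) [0..<N]),
     list_encode (map (\<lambda>k. list_encode (map (\<lambda>r. int_encode (B r k)) [0..<N])) [0..<N]),
     list_encode (map (\<lambda>j. list_encode (map (\<lambda>i. rat_encode (X j i)) [0..<N])) [0..<N]),
     list_encode (map K [0..<N])]"
  have piv: "pivot w i \<longleftrightarrow> i \<in> J" if "i < N" for i
    using that by (simp add: pivot_def w_def nth_code_list_encode del: list_encode.simps)
  have mat: "mat_entry w r k = B r k" if "r < N" "k < N" for r k
    using that by (simp add: mat_entry_def w_def nth_code_list_encode del: list_encode.simps)
  have comb: "comb_entry w j i = X j i" if "j < N" "i < N" for j i
    using that
    by (simp add: comb_entry_def w_def nth_code_list_encode rat_decode_encode del: list_encode.simps)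
  have ind: "comb_index w i = K i" if "i < N" for i
    using that by (simp add: comb_index_def w_def nth_code_list_encode del: list_encode.simps)
  have "(\<Sum>k<N. of_int (mat_entry w r k) * vec_entry n t k) = 0" if r: "r < N" for t r
  proof (cases "r \<in> J")
    case True
    then show ?thesis using r by (simp add: mat B_def)
  next
    case False
    have B: "of_int (B r k) = (if k = r then of_int m else 0) - (if k \<in> J then of_int m * g k r else 0)"
      if "k < N" for k
      using False m(2) r by (auto simp: B_def)
    have "(\<Sum>k<N. of_int (mat_entry w r k) * vec_entry n t k)
        = (\<Sum>k<N. (if k = r then of_int m * vec_entry n t r else 0)
             - (if k \<in> J then of_int m * (vec_entry n t k * g k r) else 0))"
      using r False by (intro sum.cong) (auto simp: mat B)
    also have "\<dots> = of_int m * vec_entry n t r - (\<Sum>k\<in>J. of_int m * (vec_entry n t k * g k r))"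
      using r J by (simp add: sum_subtractf sum.inter_restrict[symmetric] Int_absorb1)
    also have "\<dots> = of_int m * (vec_entry n t r - (\<Sum>k\<in>J. vec_entry n t k * g k r))"
      by (simp add: sum_distrib_left right_diff_distrib)
    also have "\<dots> = 0" using V r by simp
    finally show ?thesis .
  qed
  moreover have "(\<Sum>i<N. comb_entry w j i * vec_entry n (comb_index w i) l) = of_bool (j = l)"
    if "j < N" "l < N" "pivot w j" "pivot w l" for j l
  proof -
    have "(\<Sum>i<N. comb_entry w j i * vec_entry n (comb_index w i) l)
        = (\<Sum>i<N. if i \<in> J then x j i * vec_entry n (K i) l else 0)"
      using that by (intro sum.cong) (auto simp: comb ind X_def)
    also have "\<dots> = (\<Sum>i\<in>J. x j i * vec_entry n (K i) l)"
      using J by (simp add: sum.inter_restrict[symmetric] Int_absorb1)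
    finally show ?thesis using that gx delta by (simp add: piv)
  qed
  moreover have "mat_entry w p p \<noteq> 0" "\<forall>k<N. \<not> pivot w k \<and> k \<noteq> p \<longrightarrow> mat_entry w p k = 0"
    if "p < N" "\<not> pivot w p" for p
    using that m(1) by (auto simp: mat piv B_def)
  ultimately have "certifies N n w" by (auto simp: certifies_def)
  then show ?thesis ..
qed


section \<open>Coordinates on the exterior square\<close>

definition wedge_dim :: "nat \<Rightarrow> nat" where
  "wedge_dim d = length (wedge_index_list d)"

definition wedge_nth :: "nat \<Rightarrow> nat \<Rightarrow> nat \<times> nat" where
  "wedge_nth d k = wedge_index_list d ! k"

lemma bij_betw_wedge_nth: "bij_betw (wedge_nth d) {..<wedge_dim d} (wedge_index d)"
proof -
  have "distinct (concat (map (\<lambda>i. map (Pair i) [Suc i..<d]) xs))" if "distinct xs" for xs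
    using that by (induction xs) (auto simp: distinct_map inj_on_def)
  then have "distinct (wedge_index_list d)" by (simp add: wedge_index_list_def)
  then show ?thesis
    using bij_betw_nth[of "wedge_index_list d" "{..<wedge_dim d}" "wedge_index d"]
    by (simp add: wedge_dim_def wedge_nth_def[abs_def] set_wedge_index_list)
qed

lemma wedge_nth_in: "k < wedge_dim d \<Longrightarrow> wedge_nth d k \<in> wedge_index d"
  using bij_betw_wedge_nth[of d] by (auto simp: bij_betw_def)

lemma wedge_nth_eq_iff:
  "k < wedge_dim d \<Longrightarrow> l < wedge_dim d \<Longrightarrow> wedge_nth d k = wedge_nth d l \<longleftrightarrow> k = l"
  using bij_betw_wedge_nth[of d] by (auto simp: bij_betw_def inj_on_def)

lemma wedge_index_nthE:
  assumes "p \<in> wedge_index d"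
  obtains k where "k < wedge_dim d" "p = wedge_nth d k"
  using assms bij_betw_wedge_nth[of d] by (auto simp: bij_betw_def)

lemma map_wedge_index_list:
  "map f (wedge_index_list d) = map (\<lambda>k. f (wedge_nth d k)) [0..<wedge_dim d]"
  by (rule nth_equalityI) (auto simp: wedge_dim_def wedge_nth_def)

lemma poly_mapping_eq_wedgeI:
  assumes "Poly_Mapping.keys x \<subseteq> wedge_index d" "Poly_Mapping.keys y \<subseteq> wedge_index d"
    and "\<And>k. k < wedge_dim d \<Longrightarrow>
      Poly_Mapping.lookup x (wedge_nth d k) = Poly_Mapping.lookup y (wedge_nth d k)"
  shows "x = y"
proof (rule poly_mapping_eqI)
  fix p
  show "Poly_Mapping.lookup x p = Poly_Mapping.lookup y p"
  proof (cases "p \<in> wedge_index d")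
    case True
    then show ?thesis using assms(3) by (auto elim: wedge_index_nthE)
  next
    case False
    then show ?thesis using assms(1,2) by (metis in_keys_iff subsetD)
  qed
qed

definition wedge_of_coords :: "nat \<Rightarrow> (nat \<Rightarrow> int) \<Rightarrow> ((nat \<times> nat) \<Rightarrow>\<^sub>0 int)" where
  "wedge_of_coords d f = (\<Sum>k<wedge_dim d. frag_cmul (f k) (frag_of (wedge_nth d k)))"

lemma lookup_wedge_of_coords:
  "k < wedge_dim d \<Longrightarrow> Poly_Mapping.lookup (wedge_of_coords d f) (wedge_nth d k) = f k"
proof -
  assume k: "k < wedge_dim d"
  have "Poly_Mapping.lookup (wedge_of_coords d f) (wedge_nth d k)
      = (\<Sum>l<wedge_dim d. if l = k then f k else 0)"
    unfolding wedge_of_coords_def lookup_sum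
    using k by (intro sum.cong) (auto simp: wedge_nth_eq_iff)
  then show ?thesis using k by simp
qed

lemma keys_wedge_of_coords: "Poly_Mapping.keys (wedge_of_coords d f) \<subseteq> wedge_index d"
proof
  fix p assume "p \<in> Poly_Mapping.keys (wedge_of_coords d f)"
  then have "(\<Sum>l<wedge_dim d. Poly_Mapping.lookup (frag_cmul (f l) (frag_of (wedge_nth d l))) p) \<noteq> 0"
    by (simp add: in_keys_iff wedge_of_coords_def lookup_sum)
  then obtain l where "l < wedge_dim d" "Poly_Mapping.lookup (frag_cmul (f l) (frag_of (wedge_nth d l))) p \<noteq> 0"
    by (metis (no_types, lifting) lessThan_iff sum.neutral)
  then show "p \<in> wedge_index d" using wedge_nth_in by (auto split: if_splits)
qed


section \<open>The alternating map of a certificate\<close>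

definition matrix_map :: "nat \<Rightarrow> nat \<Rightarrow> ((nat \<times> nat) \<Rightarrow>\<^sub>0 int) \<Rightarrow> (nat \<Rightarrow>\<^sub>0 int)" where
  "matrix_map d w x = (\<Sum>r<wedge_dim d.
     frag_cmul (\<Sum>k<wedge_dim d. mat_entry w r k * Poly_Mapping.lookup x (wedge_nth d k)) (frag_of r))"

lemma lookup_matrix_map:
  "Poly_Mapping.lookup (matrix_map d w x) r = (if r < wedge_dim d
     then \<Sum>k<wedge_dim d. mat_entry w r k * Poly_Mapping.lookup x (wedge_nth d k) else 0)"
proof -
  let ?s = "\<lambda>r. \<Sum>k<wedge_dim d. mat_entry w r k * Poly_Mapping.lookup x (wedge_nth d k)"
  have "Poly_Mapping.lookup (matrix_map d w x) r = (\<Sum>r'<wedge_dim d. if r' = r then ?s r else 0)"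
    unfolding matrix_map_def lookup_sum by (intro sum.cong) auto
  then show ?thesis by simp
qed

lemma alternating_matrix_map: "alternating_map d (wedge_dim d) (matrix_map d w)"
  unfolding alternating_map_def
proof (rule homI)
  show "matrix_map d w x \<in> carrier (int_vec (wedge_dim d))" for x
    by (auto simp: in_keys_iff lookup_matrix_map split: if_splits)
  show "matrix_map d w (x \<otimes>\<^bsub>ext2_int d\<^esub> y)
      = matrix_map d w x \<otimes>\<^bsub>int_vec (wedge_dim d)\<^esub> matrix_map d w y" for x y
    by (rule poly_mapping_eqI) (simp add: lookup_matrix_map lookup_add distrib_left sum.distrib)
qed

lemma ker_lattice_matrix_map:
  "x \<in> ker_lattice d (wedge_dim d) (matrix_map d w) \<longleftrightarrow> Poly_Mapping.keys x \<subseteq> wedge_index d \<and>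
     (\<forall>r<wedge_dim d. (\<Sum>k<wedge_dim d. mat_entry w r k * Poly_Mapping.lookup x (wedge_nth d k)) = 0)"
proof -
  have "matrix_map d w x = 0 \<longleftrightarrow>
     (\<forall>r<wedge_dim d. (\<Sum>k<wedge_dim d. mat_entry w r k * Poly_Mapping.lookup x (wedge_nth d k)) = 0)"
    by (auto simp: poly_mapping_eq_iff fun_eq_iff lookup_matrix_map split: if_splits)
  then show ?thesis by (simp add: ker_lattice_def kernel_def)
qed

text \<open>The entries of \<open>w\<close> already are integer codes and are copied unchanged. They
  are reread position by position because the lists in \<open>w\<close> may have any length, while a
  query must be exactly \<open>N\<close> by \<open>N\<close>.\<close>

definition matrix_code :: "nat \<Rightarrow> nat \<Rightarrow> nat" where
  "matrix_code N w = prod_encode (N, list_encode (map (\<lambda>k. list_encode (map (\<lambda>r.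
     nth_code r (nth_code k (nth_code 1 w))) [0..<N])) [0..<N]))"

lemma map_code_matrix_map: "map_code d (wedge_dim d) (matrix_map d w) = matrix_code (wedge_dim d) w"
proof -
  have "int_encode (Poly_Mapping.lookup (matrix_map d w (frag_of (wedge_nth d k))) r)
      = nth_code r (nth_code k (nth_code 1 w))" if "k < wedge_dim d" "r < wedge_dim d" for k r
  proof -
    have "Poly_Mapping.lookup (matrix_map d w (frag_of (wedge_nth d k))) r
        = (\<Sum>l<wedge_dim d. if l = k then mat_entry w r k else 0)"
      unfolding lookup_matrix_map using that
      by (simp only: if_True) (intro sum.cong, auto simp: wedge_nth_eq_iff)
    then show ?thesis using that by (simp add: mat_entry_def)
  qed
  then show ?thesis
    unfolding map_code_def matrix_code_def map_wedge_index_list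
    by (auto intro!: arg_cong[where f = list_encode])
qed

lemma total_rec_matrix_code: "total_rec (\<lambda>w. matrix_code N w)"
  unfolding matrix_code_def
  by (intro total_rec_pair total_rec_const total_rec_list_encode_map total_rec_nth_code total_rec_id)

lemma subgroup_ker_lattice:
  assumes "alternating_map d c \<beta>"
  shows "subgroup (ker_lattice d c \<beta>) (ext2_int d)"
proof -
  have "group_hom (ext2_int d) (int_vec c) \<beta>"
    using assms by (intro group_hom.intro group_hom_axioms.intro)
      (auto simp: alternating_map_def)
  then show ?thesis unfolding ker_lattice_def by (rule group_hom.subgroup_kernel)
qed

text \<open>If n x lies in the kernel then n times the image of x is 0 in a torsion-free group, so x
  lies in the kernel. Thus \<open>matrix_map\<close> is an admissible input.\<close>

lemma saturated_ker_lattice: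
  assumes "alternating_map d c \<beta>"
  shows "saturated d (ker_lattice d c \<beta>)"
proof -
  let ?L = "ker_lattice d c \<beta>" and ?E = "ext2_int d"
  have sub: "subgroup ?L ?E" by (rule subgroup_ker_lattice[OF assms])
  have hom: "\<beta> \<in> hom ?E (int_vec c)" using assms by (simp add: alternating_map_def)
  interpret E: comm_group ?E by (rule abelian_free_Abelian_group)
  interpret L: normal ?L ?E using sub by (rule E.subgroup_imp_normal)
  interpret Q: group "?E Mod ?L" by (rule L.factorgroup_is_group)
  interpret pi: group_hom ?E "?E Mod ?L" "\<lambda>x. ?L #>\<^bsub>?E\<^esub> x"
    by (intro group_hom.intro group_hom_axioms.intro L.r_coset_hom_Mod E.group_axioms Q.group_axioms)
  have "X = \<one>\<^bsub>?E Mod ?L\<^esub>"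
    if X: "X \<in> carrier (?E Mod ?L)" and n: "n > 0" "X [^]\<^bsub>?E Mod ?L\<^esub> n = \<one>\<^bsub>?E Mod ?L\<^esub>" for X and n :: nat
  proof -
    obtain x where x: "x \<in> carrier ?E" "X = ?L #>\<^bsub>?E\<^esub> x"
      using X by (auto simp: FactGroup_def RCOSETS_def)
    have "?L #>\<^bsub>?E\<^esub> (x [^]\<^bsub>?E\<^esub> n) = ?L"
      using n(2) x pi.hom_nat_pow[of x n] by (simp add: FactGroup_def)
    then have "x [^]\<^bsub>?E\<^esub> n \<in> ?L"
      using x by (intro E.coset_join1[OF _ _ sub]) auto
    then have "\<beta> (x [^]\<^bsub>?E\<^esub> n) = 0" by (simp add: ker_lattice_def kernel_def)
    then have "frag_cmul (int n) (\<beta> x) = 0"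
      using hom_nat_pow[OF hom x(1), of n] by simp
    then have "\<beta> x = 0" using n(1) by (auto simp: poly_mapping_eq_iff fun_eq_iff)
    then have "x \<in> ?L" using x(1) by (simp add: ker_lattice_def kernel_def)
    then show ?thesis using x E.coset_join2[OF x(1) sub] by (simp add: FactGroup_def)
  qed
  then show ?thesis using sub by (auto simp: saturated_def torsion_free_def)
qed


section \<open>Decomposable vectors and the Pluecker quadrics\<close>

text \<open>The factors are the contractions of x with two basis directions; the Pluecker relations
  identify their wedge with x_ij x. Asking only for this multiple avoids division in the
  integers.\<close>

lemma plucker_imp_decomposable:
  fixes x :: "(nat \<times> nat) \<Rightarrow>\<^sub>0 int"
  assumes x: "Poly_Mapping.keys x \<subseteq> wedge_index d"
    and plucker: "\<And>i j k l. i < j \<Longrightarrow> j < k \<Longrightarrow> k < l \<Longrightarrow> l < d \<Longrightarrow>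
        Poly_Mapping.lookup x (i, j) * Poly_Mapping.lookup x (k, l)
        - Poly_Mapping.lookup x (i, k) * Poly_Mapping.lookup x (j, l)
        + Poly_Mapping.lookup x (i, l) * Poly_Mapping.lookup x (j, k) = 0"
    and ij: "i < j" "j < d"
  shows "\<exists>a b. a \<in> carrier (int_vec d) \<and> b \<in> carrier (int_vec d)
    \<and> wedge d a b = frag_cmul (Poly_Mapping.lookup x (i, j)) x"
proof -
  \<comment> \<open>The alternating matrix of \<open>x\<close>, which allows indices in any
    order.\<close>
  define Q where "Q k l = (if k < l then Poly_Mapping.lookup x (k, l)
    else if l < k then - Poly_Mapping.lookup x (l, k) else 0)" for k l
  define vec :: "(nat \<Rightarrow> int) \<Rightarrow> (nat \<Rightarrow>\<^sub>0 int)"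
    where "vec f = (\<Sum>k<d. frag_cmul (f k) (frag_of k))" for f
  have lookup_vec: "Poly_Mapping.lookup (vec f) k = (if k < d then f k else 0)" for f k
  proof -
    have "Poly_Mapping.lookup (vec f) k = (\<Sum>l<d. if l = k then f k else 0)"
      unfolding vec_def lookup_sum by (intro sum.cong) auto
    then show ?thesis by simp
  qed
  have Q: "Q k j * Q i l - Q l j * Q i k = Q i j * Q k l" if kl: "k < l" "l < d" for k l
  proof -
    \<comment> \<open>Four coincidences, where the identity follows from antisymmetry, and the six
      interleavings of two disjoint pairs, each an instance of one Pluecker relation.\<close>
    consider "i = k" | "i = l" | "j = k" | "j = l" | "j < k" | "i < k" "k < j" "j < l"
      | "i < k" "l < j" | "k < i" "j < l" | "k < i" "i < l" "l < j" | "l < i"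
      using ij kl by linarith
    then show ?thesis
    proof cases
      case 5 then show ?thesis using plucker[of i j k l] ij kl by (simp add: Q_def algebra_simps)
    next
      case 6 then show ?thesis using plucker[of i k j l] ij kl by (simp add: Q_def algebra_simps)
    next
      case 7 then show ?thesis using plucker[of i k l j] ij kl by (simp add: Q_def algebra_simps)
    next
      case 8 then show ?thesis using plucker[of k i j l] ij kl by (simp add: Q_def algebra_simps)
    next
      case 9 then show ?thesis using plucker[of k i l j] ij kl by (simp add: Q_def algebra_simps)
    next
      case 10 then show ?thesis using plucker[of k l i j] ij kl by (simp add: Q_def algebra_simps)
    qed (use ij kl in \<open>auto simp: Q_def\<close>)
  qed
  have "wedge d (vec (\<lambda>k. Q k j)) (vec (\<lambda>l. Q i l)) = frag_cmul (Poly_Mapping.lookup x (i, j)) x"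
  proof (rule poly_mapping_eqI)
    fix p :: "nat \<times> nat"
    obtain k l where p: "p = (k, l)" by (cases p)
    show "Poly_Mapping.lookup (wedge d (vec (\<lambda>k. Q k j)) (vec (\<lambda>l. Q i l))) p
        = Poly_Mapping.lookup (frag_cmul (Poly_Mapping.lookup x (i, j)) x) p"
    proof (cases "k < l \<and> l < d")
      case True
      then show ?thesis using Q[of k l] ij by (simp add: p lookup_wedge lookup_vec) (simp add: Q_def)
    next
      case False
      then have "(k, l) \<notin> Poly_Mapping.keys x" using x by (auto simp: wedge_index_def)
      then show ?thesis using False by (auto simp: p lookup_wedge in_keys_iff)
    qed
  qed
  moreover have "vec f \<in> carrier (int_vec d)" for f
    by (auto simp: in_keys_iff lookup_vec split: if_splits)
  ultimately show ?thesis by blast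
qed

text \<open>The quadrics are homogeneous, so a nonzero solution makes its whole line a point of the
  section.\<close>

lemma section_points_nonempty_iff:
  assumes U: "rat_vec.subspace U" "U \<subseteq> ext2_rat d"
  shows "section_points d U \<noteq> {} \<longleftrightarrow> (\<exists>q\<in>U. q \<noteq> 0 \<and> on_plucker_quadrics d q)"
proof
  assume "section_points d U \<noteq> {}"
  then show "\<exists>q\<in>U. q \<noteq> 0 \<and> on_plucker_quadrics d q"
    using rat_vec.span_base[of _ "{_}"]
    by (fastforce simp: section_points_def proj_points_def grassmannian_points_def)
next
  assume "\<exists>q\<in>U. q \<noteq> 0 \<and> on_plucker_quadrics d q"
  then obtain q where q: "q \<in> U" "q \<noteq> 0" "on_plucker_quadrics d q" by blast
  have "on_plucker_quadrics d (rat_scale c q)" for c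
    unfolding on_plucker_quadrics_def
  proof (intro allI impI)
    fix i j k l assume *: "i < j \<and> j < k \<and> k < l \<and> l < d"
    have "c * c * (Poly_Mapping.lookup q (i, j) * Poly_Mapping.lookup q (k, l)
        - Poly_Mapping.lookup q (i, k) * Poly_Mapping.lookup q (j, l)
        + Poly_Mapping.lookup q (i, l) * Poly_Mapping.lookup q (j, k)) = 0"
      using q(3) * by (simp add: on_plucker_quadrics_def)
    then show "Poly_Mapping.lookup (rat_scale c q) (i, j) * Poly_Mapping.lookup (rat_scale c q) (k, l)
        - Poly_Mapping.lookup (rat_scale c q) (i, k) * Poly_Mapping.lookup (rat_scale c q) (j, l)
        + Poly_Mapping.lookup (rat_scale c q) (i, l) * Poly_Mapping.lookup (rat_scale c q) (j, k) = 0"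
      by (simp add: algebra_simps)
  qed
  then have "rat_vec.span {q} \<in> section_points d U"
    using q U by (auto simp: section_points_def proj_points_def grassmannian_points_def
        rat_vec.span_singleton)
  then show "section_points d U \<noteq> {}" by blast
qed


section \<open>Subspaces presented by a certificate\<close>

lemma generate_one_ext2_int: "generate (ext2_int d) {\<one>\<^bsub>ext2_int d\<^esub>} = {0}"
  using group.generate_one[OF group_free_Abelian_group[of "wedge_index d"]] by simp

text \<open>Nothing but acceptance is assumed of \<open>w\<close>, as the search may return a
  certificate other than the one built in \<open>ex_certificate\<close>.\<close>

locale certified_subspace =
  fixes d w :: nat and us :: "((nat \<times> nat) \<Rightarrow>\<^sub>0 rat) list"
  assumes us: "set us \<subseteq> ext2_rat d"
    and cert: "certifies (wedge_dim d) (ext2_code rat_encode d us) w"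
begin

abbreviation "N \<equiv> wedge_dim d"
abbreviation "L \<equiv> ker_lattice d N (matrix_map d w)"
abbreviation "D \<equiv> decomposable_subgroup d N (matrix_map d w)"
abbreviation "pivots \<equiv> {j. j < N \<and> pivot w j}"
abbreviation "combs \<equiv> comb_vec N (ext2_code rat_encode d us) w"

lemma vec_entry_us:
  assumes "k < N"
  shows "vec_entry (ext2_code rat_encode d us) t k =
    (if t < length us then Poly_Mapping.lookup (us ! t) (wedge_nth d k) else 0)"
  using assms
  by (simp add: vec_entry_def ext2_code_def map_wedge_index_list nth_code_list_encode
      rat_decode_encode nth_code_0 rat_decode_0)

text \<open>The matrix kills the generators; conversely a kernel vector expands in the certified
  combinations of generators, with its pivot coordinates as coefficients.\<close>

lemma mem_span_iff:
  assumes q: "q \<in> ext2_rat d"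
  shows "q \<in> rat_vec.span (set us) \<longleftrightarrow>
    (\<forall>r<N. (\<Sum>k<N. of_int (mat_entry w r k) * Poly_Mapping.lookup q (wedge_nth d k)) = 0)"
proof
  assume "q \<in> rat_vec.span (set us)"
  then show "\<forall>r<N. (\<Sum>k<N. of_int (mat_entry w r k) * Poly_Mapping.lookup q (wedge_nth d k)) = 0"
  proof (induction rule: rat_vec.span_induct_alt)
    case (step c u v)
    then obtain t where t: "t < length us" "u = us ! t" by (metis in_set_conv_nth)
    have "(\<Sum>k<N. of_int (mat_entry w r k) * Poly_Mapping.lookup u (wedge_nth d k)) = 0" if "r < N" for r
      using certifies_kernelD[OF cert that, of t] t by (simp add: vec_entry_us)
    moreover have "(\<Sum>k<N. of_int (mat_entry w r k) * Poly_Mapping.lookup (rat_scale c u + v) (wedge_nth d k))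
        = c * (\<Sum>k<N. of_int (mat_entry w r k) * Poly_Mapping.lookup u (wedge_nth d k))
          + (\<Sum>k<N. of_int (mat_entry w r k) * Poly_Mapping.lookup v (wedge_nth d k))" for r
      by (simp add: lookup_add distrib_left sum.distrib sum_distrib_left ac_simps)
    ultimately show ?case using step.IH by simp
  qed simp
next
  assume ker: "\<forall>r<N. (\<Sum>k<N. of_int (mat_entry w r k) * Poly_Mapping.lookup q (wedge_nth d k)) = 0"
  \<comment> \<open>An index in the certificate may point past the end of \<open>us\<close>, where
    \<open>vec_entry\<close> reads 0; \<open>u\<close> follows the same convention.\<close>
  define u where "u t = (if t < length us then us ! t else 0)" for t
  have u: "u t \<in> rat_vec.span (set us)" for t
    by (auto simp: u_def intro: rat_vec.span_base rat_vec.span_zero)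
  have u_ext: "Poly_Mapping.lookup (u t) p = 0" if "p \<notin> wedge_index d" for t p
  proof -
    have "Poly_Mapping.keys (u t) \<subseteq> wedge_index d"
      using us nth_mem[of t us] unfolding u_def ext2_rat_def by (cases "t < length us") force+
    then show ?thesis using that by (metis in_keys_iff subsetD)
  qed
  define q' where "q' = (\<Sum>j\<in>pivots. rat_scale (Poly_Mapping.lookup q (wedge_nth d j))
    (\<Sum>i<N. rat_scale (comb_entry w j i) (u (comb_index w i))))"
  have "q = q'"
  proof (rule poly_mapping_eq_wedgeI)
    show "Poly_Mapping.keys q \<subseteq> wedge_index d" using q by (simp add: ext2_rat_def)
    show "Poly_Mapping.keys q' \<subseteq> wedge_index d"
      by (rule subsetI, rule ccontr) (simp add: in_keys_iff q'_def lookup_sum u_ext)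
    fix l assume l: "l < N"
    have "Poly_Mapping.lookup (u t) (wedge_nth d l) = vec_entry (ext2_code rat_encode d us) t l" for t
      using l by (simp add: u_def vec_entry_us)
    then show "Poly_Mapping.lookup q (wedge_nth d l) = Poly_Mapping.lookup q' (wedge_nth d l)"
      using certifies_kernel_span[OF cert, of "\<lambda>k. Poly_Mapping.lookup q (wedge_nth d k)"] ker l
      by (simp add: q'_def lookup_sum comb_vec_def)
  qed
  also have "q' \<in> rat_vec.span (set us)"
    unfolding q'_def by (intro rat_vec.span_sum rat_vec.span_scale u)
  finally show "q \<in> rat_vec.span (set us)" .
qed

section \<open>The groups \<open>L\<close> and \<open>D\<close> and the rank of their
  quotient\<close>

lemma comm_group_L: "comm_group ((ext2_int d)\<lparr>carrier := L\<rparr>)"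
  by (rule group.group_comm_groupI[OF subgroup.subgroup_is_group[OF
        subgroup_ker_lattice[OF alternating_matrix_map] group_free_Abelian_group]])
    (simp add: add.commute)

lemma decomposables_subset_L:
  "{wedge d a b | a b. a \<in> carrier (int_vec d) \<and> b \<in> carrier (int_vec d)
     \<and> matrix_map d w (wedge d a b) = \<one>\<^bsub>int_vec N\<^esub>} \<subseteq> L"
  using wedge_in_carrier by (auto simp: ker_lattice_def kernel_def)

lemma D_subset_L: "D \<subseteq> L"
  unfolding decomposable_subgroup_def
  by (intro group.generate_subgroup_incl decomposables_subset_L subgroup_ker_lattice
      alternating_matrix_map group_free_Abelian_group)

lemma subgroup_D: "subgroup D (ext2_int d)"
  unfolding decomposable_subgroup_def using wedge_in_carrier
  by (intro group.generate_is_subgroup group_free_Abelian_group) blast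

lemma subgroup_D_L: "subgroup D ((ext2_int d)\<lparr>carrier := L\<rparr>)"
  by (intro group.subgroup_incl group_free_Abelian_group subgroup_D D_subset_L
      subgroup_ker_lattice alternating_matrix_map)

text \<open>A rational point yields a vector of \<open>L\<close> after clearing denominators and a
  decomposable one after a further scaling by a nonzero coordinate. Conversely, every wedge
  satisfies the Pluecker relations.\<close>

lemma section_points_nonempty_iff_D:
  "section_points d (rat_vec.span (set us)) \<noteq> {} \<longleftrightarrow> D \<noteq> {0}"
proof -
  let ?U = "rat_vec.span (set us)"
  have U: "rat_vec.subspace ?U" "?U \<subseteq> ext2_rat d"
  proof -
    have "rat_vec.subspace (ext2_rat d)"
      unfolding ext2_rat_def
    proof (rule rat_vec.subspaceI)
      fix x y :: "(nat \<times> nat) \<Rightarrow>\<^sub>0 rat" and c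
      assume "x \<in> {q. Poly_Mapping.keys q \<subseteq> wedge_index d}" "y \<in> {q. Poly_Mapping.keys q \<subseteq> wedge_index d}"
      then show "x + y \<in> {q. Poly_Mapping.keys q \<subseteq> wedge_index d}"
        using Poly_Mapping.keys_add[of x y] by auto
    next
      fix c and x :: "(nat \<times> nat) \<Rightarrow>\<^sub>0 rat"
      assume "x \<in> {q. Poly_Mapping.keys q \<subseteq> wedge_index d}"
      then show "rat_scale c x \<in> {q. Poly_Mapping.keys q \<subseteq> wedge_index d}"
        by (auto simp: in_keys_iff subset_iff)
    qed simp
    then show "?U \<subseteq> ext2_rat d" by (rule rat_vec.span_minimal[OF us])
  qed simp
  show ?thesis
  proof
    assume "section_points d ?U \<noteq> {}"
    then obtain q where q: "q \<in> ?U" "q \<noteq> 0" "on_plucker_quadrics d q"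
      using section_points_nonempty_iff[OF U] by blast
    have q_ext: "Poly_Mapping.keys q \<subseteq> wedge_index d" using q(1) U by (auto simp: ext2_rat_def)
    obtain m :: int where m: "m > 0"
      "\<forall>k\<in>{..<N}. of_int m * Poly_Mapping.lookup q (wedge_nth d k) \<in> \<int>"
      using ex_common_denominator[of "{..<N}" "\<lambda>k. Poly_Mapping.lookup q (wedge_nth d k)"] by auto
    \<comment> \<open>The floor is exact, since \<open>m\<close> clears all denominators of
      \<open>q\<close>.\<close>
    define x where "x = wedge_of_coords d (\<lambda>k. \<lfloor>of_int m * Poly_Mapping.lookup q (wedge_nth d k)\<rfloor>)"
    have x_ext: "Poly_Mapping.keys x \<subseteq> wedge_index d" unfolding x_def by (rule keys_wedge_of_coords)
    have lx: "of_int (Poly_Mapping.lookup x p) = of_int m * Poly_Mapping.lookup q p"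
      if "p \<in> wedge_index d" for p
      using that m(2) by (elim wedge_index_nthE) (simp add: x_def lookup_wedge_of_coords)
    have xL: "x \<in> L"
      unfolding ker_lattice_matrix_map
    proof (intro conjI x_ext allI impI)
      fix r assume r: "r < N"
      have "of_int (\<Sum>k<N. mat_entry w r k * Poly_Mapping.lookup x (wedge_nth d k))
          = of_int m * (\<Sum>k<N. of_int (mat_entry w r k) * Poly_Mapping.lookup q (wedge_nth d k))"
        by (simp add: lx wedge_nth_in sum_distrib_left ac_simps)
      also have "\<dots> = 0" using mem_span_iff q(1) U r by auto
      finally show "(\<Sum>k<N. mat_entry w r k * Poly_Mapping.lookup x (wedge_nth d k)) = 0"
        by (simp only: of_int_eq_0_iff)
    qed
    obtain p where p: "Poly_Mapping.lookup q p \<noteq> 0"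
      using q(2) by (auto simp: poly_mapping_eq_iff fun_eq_iff)
    then have pw: "p \<in> wedge_index d" using q_ext by (auto simp: in_keys_iff)
    then obtain i j where ij: "p = (i, j)" "i < j" "j < d" by (auto simp: wedge_index_def)
    have xp: "Poly_Mapping.lookup x p \<noteq> 0"
      using lx[OF pw] p m(1) by auto
    have "Poly_Mapping.lookup x (i, j) * Poly_Mapping.lookup x (k, l)
        - Poly_Mapping.lookup x (i, k) * Poly_Mapping.lookup x (j, l)
        + Poly_Mapping.lookup x (i, l) * Poly_Mapping.lookup x (j, k) = 0"
      if ijkl: "i < j" "j < k" "k < l" "l < d" for i j k l
    proof -
      have "of_int (Poly_Mapping.lookup x (i, j) * Poly_Mapping.lookup x (k, l)
        - Poly_Mapping.lookup x (i, k) * Poly_Mapping.lookup x (j, l)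
        + Poly_Mapping.lookup x (i, l) * Poly_Mapping.lookup x (j, k))
        = of_int m * of_int m * (Poly_Mapping.lookup q (i, j) * Poly_Mapping.lookup q (k, l)
        - Poly_Mapping.lookup q (i, k) * Poly_Mapping.lookup q (j, l)
        + Poly_Mapping.lookup q (i, l) * Poly_Mapping.lookup q (j, k))"
        using ijkl by (simp add: lx wedge_index_def algebra_simps)
      also have "\<dots> = 0" using q(3) ijkl by (simp add: on_plucker_quadrics_def)
      finally show ?thesis by (simp only: of_int_eq_0_iff)
    qed
    then obtain a b where ab: "a \<in> carrier (int_vec d)" "b \<in> carrier (int_vec d)"
        "wedge d a b = frag_cmul (Poly_Mapping.lookup x p) x"
      using plucker_imp_decomposable[OF x_ext _ ij(2,3)] ij(1) by metis
    have "wedge d a b \<in> L"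
      using xL wedge_in_carrier[of d a b]
      by (simp add: ker_lattice_matrix_map ab(3) mult.left_commute[of _ "Poly_Mapping.lookup x p"]
          sum_distrib_left[symmetric])
    then have "wedge d a b \<in> D"
      unfolding decomposable_subgroup_def using ab(1,2)
      by (intro generate.incl) (auto simp: ker_lattice_def kernel_def)
    moreover have "Poly_Mapping.lookup (wedge d a b) p \<noteq> 0"
      using xp by (simp add: ab(3))
    ultimately show "D \<noteq> {0}" by auto
  next
    assume "D \<noteq> {0}"
    \<comment> \<open>\<open>D\<close> consists of sums of decomposables, which need not be
      decomposable; so a nonzero generator is sought, not a nonzero element.\<close>
    have "\<exists>a b. wedge d a b \<in> L \<and> wedge d a b \<noteq> 0"
    proof (rule ccontr)
      assume none: "\<not> (\<exists>a b. wedge d a b \<in> L \<and> wedge d a b \<noteq> 0)"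
      have "D \<subseteq> generate (ext2_int d) {\<one>\<^bsub>ext2_int d\<^esub>}"
        unfolding decomposable_subgroup_def
        using decomposables_subset_L none
        by (intro group.mono_generate group_free_Abelian_group) (unfold one_free_Abelian_group, blast)
      then have "D \<subseteq> {0}" by (simp only: generate_one_ext2_int)
      moreover have "0 \<in> D" using subgroup.one_closed[OF subgroup_D] by simp
      ultimately show False using \<open>D \<noteq> {0}\<close> by blast
    qed
    then obtain a b where ab: "wedge d a b \<in> L" "wedge d a b \<noteq> 0" by blast
    define q :: "(nat \<times> nat) \<Rightarrow>\<^sub>0 rat" where "q = Poly_Mapping.map of_int (wedge d a b)"
    have lq: "Poly_Mapping.lookup q p = of_int (Poly_Mapping.lookup (wedge d a b) p)" for p
      by (simp add: q_def Poly_Mapping.map.rep_eq when_def)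
    have "q \<in> ext2_rat d"
      using wedge_in_carrier[of d a b] by (auto simp: ext2_rat_def in_keys_iff lq subset_iff)
    moreover have "(\<Sum>k<N. of_int (mat_entry w r k) * Poly_Mapping.lookup q (wedge_nth d k)) = 0"
      if "r < N" for r
    proof -
      have "(\<Sum>k<N. of_int (mat_entry w r k) * Poly_Mapping.lookup q (wedge_nth d k))
        = of_int (\<Sum>k<N. mat_entry w r k * Poly_Mapping.lookup (wedge d a b) (wedge_nth d k))"
        by (simp add: lq)
      then show ?thesis using ab(1) that by (simp only: ker_lattice_matrix_map of_int_0)
    qed
    ultimately have "q \<in> ?U" by (simp add: mem_span_iff)
    moreover have "q \<noteq> 0"
      using ab(2) by (auto simp: poly_mapping_eq_iff fun_eq_iff lq)
    moreover have "on_plucker_quadrics d q"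
      by (auto simp: on_plucker_quadrics_def lq lookup_wedge algebra_simps)
    ultimately show "section_points d ?U \<noteq> {}"
      using section_points_nonempty_iff[OF U] by blast
  qed
qed

text \<open>A vector of \<open>L\<close> with zero pivot coordinates is itself 0, so the torsion
  condition holds with exponent 1.\<close>

lemma coordinatized_surjection_L:
  "coordinatized_surjection ((ext2_int d)\<lparr>carrier := L\<rparr>) (ker_quotient d N (matrix_map d w))
     (\<lambda>x. D #>\<^bsub>(ext2_int d)\<lparr>carrier := L\<rparr>\<^esub> x) pivots (\<lambda>j x. Poly_Mapping.lookup x (wedge_nth d j))"
proof -
  let ?G = "(ext2_int d)\<lparr>carrier := L\<rparr>"
  interpret G: comm_group ?G by (rule comm_group_L)
  interpret D: normal D ?G by (rule G.subgroup_imp_normal[OF subgroup_D_L])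
  show ?thesis
    unfolding ker_quotient_def
  proof (rule coordinatized_surjection.intro)
    show "group (?G Mod D)" by (rule D.factorgroup_is_group)
    show "(\<lambda>x. D #>\<^bsub>?G\<^esub> x) \<in> hom ?G (?G Mod D)" by (rule D.r_coset_hom_Mod)
    show "(\<lambda>x. D #>\<^bsub>?G\<^esub> x) ` carrier ?G = carrier (?G Mod D)"
      by (auto simp: FactGroup_def RCOSETS_def)
    show "(\<lambda>x. Poly_Mapping.lookup x (wedge_nth d j)) \<in> hom ?G integer_group" for j
      by (rule homI) (auto simp: lookup_add)
    fix x assume x: "x \<in> carrier ?G" "\<forall>j\<in>pivots. Poly_Mapping.lookup x (wedge_nth d j) = 0"
    have "of_int (Poly_Mapping.lookup x (wedge_nth d l)) = (0::rat)" if "l < N" for l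
    proof (rule certifies_pivots_determine[OF cert _ _ that])
      fix r assume r: "r < N"
      have "(\<Sum>k<N. of_int (mat_entry w r k) * of_int (Poly_Mapping.lookup x (wedge_nth d k)))
        = (of_int (\<Sum>k<N. mat_entry w r k * Poly_Mapping.lookup x (wedge_nth d k)) :: rat)" by simp
      also have "\<dots> = 0"
      proof -
        have "x \<in> L" using x(1) by simp
        then show ?thesis using r by (simp only: ker_lattice_matrix_map of_int_0)
      qed
      finally show "(\<Sum>k<N. of_int (mat_entry w r k) * of_int (Poly_Mapping.lookup x (wedge_nth d k))) = (0::rat)" .
    qed (use x in auto)
    then have "x = 0"
      using x(1) by (intro poly_mapping_eq_wedgeI[of _ d]) (auto simp: ker_lattice_matrix_map)
    then show "\<exists>n::nat. n > 0 \<and> x [^]\<^bsub>?G\<^esub> n = \<one>\<^bsub>?G\<^esub>"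
      by (intro exI[of _ 1]) (simp add: nat_pow_def)
  qed (use comm_group_L in auto)
qed

sublocale L: coordinatized_surjection "(ext2_int d)\<lparr>carrier := L\<rparr>" "ker_quotient d N (matrix_map d w)"
  "\<lambda>x. D #>\<^bsub>(ext2_int d)\<lparr>carrier := L\<rparr>\<^esub> x" pivots "\<lambda>j x. Poly_Mapping.lookup x (wedge_nth d j)"
  by (rule coordinatized_surjection_L)

text \<open>With trivial \<open>D\<close> the projection is injective. A common multiple
  \<open>m\<close> makes the certified combinations integral vectors of \<open>L\<close> whose pivot
  coordinates form \<open>m\<close> times the identity matrix.\<close>

lemma ab_rank_ker_quotient_eq:
  assumes "D = {0}"
  shows "ab_rank (ker_quotient d N (matrix_map d w)) = card pivots"
proof -
  obtain m :: int where m: "m > 0" "\<forall>a\<in>{..<N} \<times> {..<N}. of_int m * (\<lambda>(j, k). combs j k) a \<in> \<int>"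
    using ex_common_denominator[of "{..<N} \<times> {..<N}" "\<lambda>(j, k). combs j k"] by auto
  define g where "g j = wedge_of_coords d (\<lambda>k. \<lfloor>of_int m * combs j k\<rfloor>)" for j
  have lg: "of_int (Poly_Mapping.lookup (g j) (wedge_nth d k)) = of_int m * combs j k"
    if "j < N" "k < N" for j k
    using that m(2) by (simp add: g_def lookup_wedge_of_coords)
  show ?thesis
  proof (rule L.ab_rank_eq)
    show "inj_on (\<lambda>x. D #>\<^bsub>(ext2_int d)\<lparr>carrier := L\<rparr>\<^esub> x) (carrier ((ext2_int d)\<lparr>carrier := L\<rparr>))"
      by (rule inj_onI) (simp add: assms r_coset_def)
    show "m \<noteq> 0" using m by simp
    fix j assume j: "j \<in> pivots"
    show "g j \<in> carrier ((ext2_int d)\<lparr>carrier := L\<rparr>)"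
    proof -
      have "(\<Sum>k<N. mat_entry w r k * Poly_Mapping.lookup (g j) (wedge_nth d k)) = 0" if r: "r < N" for r
      proof -
        have "of_int (\<Sum>k<N. mat_entry w r k * Poly_Mapping.lookup (g j) (wedge_nth d k))
            = of_int m * (\<Sum>k<N. of_int (mat_entry w r k) * combs j k)"
          using j by (simp add: lg sum_distrib_left ac_simps)
        also have "\<dots> = 0" using comb_vec_kernel[OF cert r] by simp
        finally show ?thesis by (simp only: of_int_eq_0_iff)
      qed
      then show ?thesis
        using keys_wedge_of_coords by (simp add: ker_lattice_matrix_map g_def)
    qed
    fix l assume l: "l \<in> pivots"
    have "rat_of_int (Poly_Mapping.lookup (g j) (wedge_nth d l)) = of_int (if j = l then m else 0)"
      using j l by (simp add: lg comb_vec_pivot[OF cert])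
    then show "Poly_Mapping.lookup (g j) (wedge_nth d l) = (if j = l then m else 0)"
      by (simp only: of_int_eq_iff)
  qed
qed

text \<open>A nonzero element of \<open>D\<close> has infinite order, because \<open>L\<close> lies
  in a free group, and dies in the quotient; this costs at least one unit of rank.\<close>

lemma ab_rank_ker_quotient_less:
  assumes "D \<noteq> {0}"
  shows "ab_rank (ker_quotient d N (matrix_map d w)) < card pivots"
proof -
  have "0 \<in> D" using subgroup.one_closed[OF subgroup_D] by simp
  then obtain z where z: "z \<in> D" "z \<noteq> 0" using assms by blast
  show ?thesis
  proof (rule L.ab_rank_less)
    show zc: "z \<in> carrier ((ext2_int d)\<lparr>carrier := L\<rparr>)" using z D_subset_L by auto
    show "D #>\<^bsub>(ext2_int d)\<lparr>carrier := L\<rparr>\<^esub> z = \<one>\<^bsub>ker_quotient d N (matrix_map d w)\<^esub>"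
      using L.G.coset_join2[OF zc subgroup_D_L z(1)] by (simp add: ker_quotient_def FactGroup_def)
    fix n :: nat assume n: "n > 0"
    have "z [^]\<^bsub>(ext2_int d)\<lparr>carrier := L\<rparr>\<^esub> n = frag_cmul (int n) z"
      using monoid.nat_pow_consistent[where G = "ext2_int d" and x = z and n = n and H = L,
          OF group.is_monoid[OF group_free_Abelian_group]]
      by simp
    then show "z [^]\<^bsub>(ext2_int d)\<lparr>carrier := L\<rparr>\<^esub> n \<noteq> \<one>\<^bsub>(ext2_int d)\<lparr>carrier := L\<rparr>\<^esub>"
      using n z by (auto simp: poly_mapping_eq_iff fun_eq_iff)
  qed
qed

lemma ab_rank_ker_quotient_iff:
  "ab_rank (ker_quotient d N (matrix_map d w)) = card pivots \<longleftrightarrow> D = {0}"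
  using ab_rank_ker_quotient_eq ab_rank_ker_quotient_less less_irrefl by metis

end


section \<open>The reduction\<close>

lemma first_zero_total:
  "first_zero (\<lambda>k. Some (f k)) = (if \<exists>k. f k = 0 then Some (LEAST k. f k = 0) else None)"
proof -
  have "(\<exists>k. f k = 0 \<and> (\<forall>j<k. \<exists>v. f j = Suc v)) \<longleftrightarrow> (\<exists>k. f k = 0)"
    using LeastI_ex[of "\<lambda>k. f k = 0"] not_less_Least[of _ "\<lambda>k. f k = 0"] by (metis not0_implies_Suc)
  then show ?thesis by (simp add: first_zero_def)
qed

text \<open>The frame shared by the three problems: \<open>A\<close> is the test that interprets the
  answer \<open>v\<close>. It also sees \<open>w\<close>, because the rank tests compare with the
  number of pivots.\<close>

lemma ex_decision_procedure:
  assumes F: "partial_recursive F"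
    and A: "decidable_pred (\<lambda>m. A (fst (prod_decode m)) (snd (prod_decode m)))"
    and F_A: "\<And>w us. certified_subspace d w us \<Longrightarrow>
      \<exists>v. F (map_code d (wedge_dim d) (matrix_map d w)) = Some v
        \<and> (A w v \<longleftrightarrow> decomposable_subgroup d (wedge_dim d) (matrix_map d w) \<noteq> {0})"
  shows "\<exists>G. partial_recursive G \<and> decides_section_points d G"
proof -
  let ?N = "wedge_dim d"
  define search where "search n = first_zero (\<lambda>w. Some (if certifies ?N n w then 0 else 1))" for n
  have search: "partial_recursive search"
    using partial_recursive.minim[OF decidable_certifies[of ?N, unfolded decidable_pred_def total_rec_def]]
    by (simp add: search_def[abs_def])
  \<comment> \<open>The certificate is paired with the answer so that it is still available to the
    final test.\<close>
  define run where "run w = Option.bind (F (matrix_code ?N w)) (\<lambda>v. Some (prod_encode (w, v)))" for w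
  have run: "partial_recursive run"
    using partial_recursive.pair[OF total_rec_id[unfolded total_rec_def]
        partial_recursive.comp[OF F total_rec_matrix_code[of ?N, unfolded total_rec_def]]]
    by (simp add: run_def[abs_def])
  define out where "out m = (if A (fst (prod_decode m)) (snd (prod_decode m)) then 1 else 0 :: nat)" for m
  have out: "partial_recursive (\<lambda>m. Some (out m))"
    using total_rec_indicator[OF A] by (simp add: total_rec_def out_def[abs_def])
  define G where "G n = Option.bind (Option.bind (search n) run) (\<lambda>m. Some (out m))" for n
  have "partial_recursive G"
    unfolding G_def[abs_def] by (intro partial_recursive.comp[OF out] partial_recursive.comp[OF run] search)
  moreover have "decides_section_points d G"
    unfolding decides_section_points_def
  proof (intro allI impI)
    fix U us assume U: "rat_vec.subspace U \<and> U \<subseteq> ext2_rat d \<and> rat_vec.span (set us) = U"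
    let ?n = "ext2_code rat_encode d us"
    obtain w where w: "search ?n = Some w" "certifies ?N ?n w"
    proof
      let ?P = "\<lambda>w. (if certifies ?N ?n w then 0 else 1 :: nat) = 0"
      have ex: "\<exists>w. ?P w" using ex_certificate[of ?N ?n] by auto
      show "search ?n = Some (LEAST w. ?P w)"
        unfolding search_def first_zero_total using ex by simp
      show "certifies ?N ?n (LEAST w. ?P w)"
        using LeastI_ex[OF ex] by (simp split: if_splits)
    qed
    have "set us \<subseteq> ext2_rat d" using U rat_vec.span_superset by blast
    then interpret certified_subspace d w us using w by unfold_locales
    obtain v where v: "F (matrix_code ?N w) = Some v" "A w v \<longleftrightarrow> D \<noteq> {0}"
      using F_A[OF certified_subspace_axioms] by (auto simp: map_code_matrix_map)
    have "G ?n = Some (if A w v then 1 else 0)"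
      by (simp add: G_def w run_def v(1) out_def)
    then show "G ?n = Some (if section_points d U \<noteq> {} then 1 else 0)"
      using section_points_nonempty_iff_D v(2) U by simp
  qed
  ultimately show ?thesis by blast
qed

section \<open>Interpreting the answers of the assumed algorithm\<close>

lemma total_rec_card_pivots: "total_rec a \<Longrightarrow> total_rec (\<lambda>n. card {j. j < N \<and> pivot (a n) j})"
proof -
  assume a: "total_rec a"
  have "card {j. j < N \<and> pivot w j} = (\<Sum>j<N. if pivot w j then 1 else 0)" for w
    by (simp add: sum.If_cases Int_def)
  moreover have "total_rec (\<lambda>n. \<Sum>j<N. if pivot (a n) j then 1 else 0)"
    by (intro total_rec_sum total_rec_indicator decidable_pivot a)
  ultimately show ?thesis by simp
qed

text \<open>Order 0 marks an infinite cyclic summand. The condition on \<open>drop_code\<close>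
  excludes positions past the end, where \<open>nth_code\<close> is 0 as well.\<close>

definition count_zeros :: "nat \<Rightarrow> nat" where
  "count_zeros v = (\<Sum>t<v. if drop_code t v \<noteq> 0 \<and> nth_code t v = 0 then 1 else 0)"

lemma count_zeros_list_encode:
  "count_zeros (list_encode ns) = card {i. i < length ns \<and> ns ! i = 0}"
proof -
  have "{t. t < list_encode ns \<and> drop_code t (list_encode ns) \<noteq> 0 \<and> nth_code t (list_encode ns) = 0}
      = {i. i < length ns \<and> ns ! i = 0}"
    using length_le_list_encode[of ns]
    by (auto simp: drop_code_list_encode_eq_0 nth_code_list_encode split: if_splits)
  then show ?thesis by (simp add: count_zeros_def sum.If_cases Int_def)
qed

lemma total_rec_count_zeros: "total_rec a \<Longrightarrow> total_rec (\<lambda>n. count_zeros (a n))"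
proof (rule total_rec_comp[of count_zeros])
  show "total_rec count_zeros"
    unfolding count_zeros_def[abs_def]
    by (intro total_rec_sum_bounded total_rec_id) (unfold total_rec2_def,
      intro total_rec_indicator decidable_conj decidable_not decidable_eq_0 total_rec_drop_code
        total_rec_nth_code total_rec_basic)
qed

theorem mainTheorem2:
  fixes d :: nat
  assumes "d \<ge> 2"
    and "(\<exists>F. partial_recursive F \<and> computes_decomposable_subgroup d F)
       \<or> (\<exists>F. partial_recursive F \<and> computes_quotient_type d F)
       \<or> (\<exists>F. partial_recursive F \<and> computes_quotient_rank d F)"
  shows "\<exists>G. partial_recursive G \<and> decides_section_points d G"
proof -
  let ?N = "wedge_dim d"
  note admissible = alternating_matrix_map saturated_ker_lattice[OF alternating_matrix_map]
  consider F where "partial_recursive F" "computes_decomposable_subgroup d F"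
    | F where "partial_recursive F" "computes_quotient_type d F"
    | F where "partial_recursive F" "computes_quotient_rank d F"
    using assms(2) by blast
  then show ?thesis
  proof cases
    case (1 F)
    show ?thesis
    \<comment> \<open>\<open>D\<close> is trivial iff all listed generators are 0. Since 0 codes the
      integer 0 and is also read past the end, letting \<open>t\<close> run up to \<open>v\<close>
      instead of the length is harmless.\<close>
    proof (rule ex_decision_procedure[OF 1(1), where A = "\<lambda>_ v. \<not> (\<forall>t<v. \<forall>k<?N. nth_code k (nth_code t v) = 0)"])
      show "decidable_pred (\<lambda>m. \<not> (\<forall>t<snd (prod_decode m). \<forall>k<?N. nth_code k (nth_code t (snd (prod_decode m))) = 0))"
        by (intro decidable_not, rule decidable_all_bounded, rule decidable_all_less)
          (intro decidable_eq_0 total_rec_nth_code total_rec_basic)+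
      fix w us assume "certified_subspace d w us"
      then interpret certified_subspace d w us .
      obtain ws where ws: "set ws \<subseteq> carrier (ext2_int d)" "generate (ext2_int d) (set ws) = D"
        "F (map_code d N (matrix_map d w)) = Some (ext2_code int_encode d ws)"
        using 1(2) admissible unfolding computes_decomposable_subgroup_def by blast
      let ?v = "ext2_code int_encode d ws"
      have entry: "nth_code k (nth_code t ?v) =
          (if t < length ws then int_encode (Poly_Mapping.lookup (ws ! t) (wedge_nth d k)) else 0)" if "k < N" for k t
        using that by (simp add: ext2_code_def map_wedge_index_list nth_code_list_encode nth_code_0)
      have zero: "int_encode z = 0 \<longleftrightarrow> z = 0" for z
        by (metis int_decode_0 int_decode_inverse int_encode_inverse)
      have len: "length ws \<le> ?v"
        using length_le_list_encode[of "map _ ws"] by (simp add: ext2_code_def)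
      have "(\<forall>t<?v. \<forall>k<N. nth_code k (nth_code t ?v) = 0) \<longleftrightarrow>
          (\<forall>t<length ws. \<forall>k<N. Poly_Mapping.lookup (ws ! t) (wedge_nth d k) = 0)"
        using len by (auto simp: entry zero)
      also have "\<dots> \<longleftrightarrow> set ws \<subseteq> {0}"
      proof
        assume *: "\<forall>t<length ws. \<forall>k<N. Poly_Mapping.lookup (ws ! t) (wedge_nth d k) = 0"
        have "x = 0" if "x \<in> set ws" for x
        proof (rule poly_mapping_eq_wedgeI)
          show "Poly_Mapping.keys x \<subseteq> wedge_index d"
            using subsetD[OF ws(1) that] by (simp only: carrier_free_Abelian_group_iff)
          show "Poly_Mapping.lookup x (wedge_nth d k) = Poly_Mapping.lookup 0 (wedge_nth d k)" if "k < N" for k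
            using * \<open>x \<in> set ws\<close> that by (auto simp: in_set_conv_nth)
        qed simp
        then show "set ws \<subseteq> {0}" by auto
      qed (use nth_mem in fastforce)
      also have "\<dots> \<longleftrightarrow> D = {0}"
      proof
        assume "set ws \<subseteq> {0}"
        then have "D \<subseteq> generate (ext2_int d) {\<one>\<^bsub>ext2_int d\<^esub>}"
          unfolding ws(2)[symmetric] by (intro group.mono_generate group_free_Abelian_group) auto
        then have "D \<subseteq> {0}" by (simp only: generate_one_ext2_int)
        moreover have "0 \<in> D" using subgroup.one_closed[OF subgroup_D] by simp
        ultimately show "D = {0}" by blast
      next
        assume "D = {0}"
        then show "set ws \<subseteq> {0}" using generate.incl[of _ "set ws" "ext2_int d"] ws(2) by blast
      qed
      finally show "\<exists>v. F (map_code d N (matrix_map d w)) = Some v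
          \<and> ((\<not> (\<forall>t<v. \<forall>k<N. nth_code k (nth_code t v) = 0)) \<longleftrightarrow> D \<noteq> {0})"
        using ws(3) by blast
    qed
  next
    case (2 F)
    show ?thesis
    \<comment> \<open>The number of infinite summands is the rank for any decomposition into cyclic
      groups, so it can be compared with rk \<open>L\<close>, the number of pivots.\<close>
    proof (rule ex_decision_procedure[OF 2(1), where A = "\<lambda>w v. count_zeros v \<noteq> card {j. j < ?N \<and> pivot w j}"])
      show "decidable_pred (\<lambda>m. count_zeros (snd (prod_decode m)) \<noteq> card {j. j < ?N \<and> pivot (fst (prod_decode m)) j})"
        by (intro decidable_not decidable_eq total_rec_count_zeros total_rec_card_pivots total_rec_basic)
      fix w us assume "certified_subspace d w us"
      then interpret certified_subspace d w us .
      obtain ns where ns: "ker_quotient d N (matrix_map d w) \<cong> cyclic_sum ns"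
        "F (map_code d N (matrix_map d w)) = Some (list_encode ns)"
        using 2(2) admissible unfolding computes_quotient_type_def by blast
      have "count_zeros (list_encode ns) = ab_rank (ker_quotient d N (matrix_map d w))"
        using ab_rank_iso_cyclic_sum[OF L.group_K ns(1)] by (simp add: count_zeros_list_encode)
      then show "\<exists>v. F (map_code d N (matrix_map d w)) = Some v \<and> (count_zeros v \<noteq> card pivots \<longleftrightarrow> D \<noteq> {0})"
        using ns(2) ab_rank_ker_quotient_iff by simp
    qed
  next
    case (3 F)
    show ?thesis
    proof (rule ex_decision_procedure[OF 3(1), where A = "\<lambda>w v. v \<noteq> card {j. j < ?N \<and> pivot w j}"])
      show "decidable_pred (\<lambda>m. snd (prod_decode m) \<noteq> card {j. j < ?N \<and> pivot (fst (prod_decode m)) j})"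
        by (intro decidable_not decidable_eq total_rec_card_pivots total_rec_basic)
      fix w us assume "certified_subspace d w us"
      then interpret certified_subspace d w us .
      have "F (map_code d N (matrix_map d w)) = Some (ab_rank (ker_quotient d N (matrix_map d w)))"
        using 3(2) admissible unfolding computes_quotient_rank_def by blast
      then show "\<exists>v. F (map_code d N (matrix_map d w)) = Some v \<and> (v \<noteq> card pivots \<longleftrightarrow> D \<noteq> {0})"
        using ab_rank_ker_quotient_iff by simp
    qed
  qed
qed

end
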